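(* Let $L>0$, $\nu>0$, $\Omega=[0,L]^3$ with periodic boundary conditions. Let $f:\Omega\to\mathbb{R}^3$ be a smooth, time-independent, $L$-periodic forcing with $\int_\Omega f\,dx=0$, satisfying $\sup_{n\ge 0}\Phi_{n+1}/\Phi_n<\infty$, $\tau^2\Phi_0>1$ and $\tau^2\Phi_1>1$. Let $u=(u_1,u_2,u_3)$, with pressure $\mathcal{P}$, be a smooth, $L$-periodic solution, defined for all $t\ge 0$, of the three-dimensional incompressible Navier-Stokes equations $$u_t+(u\cdot\nabla)u=\nu\Delta u-\nabla\mathcal{P}+f,\qquad \nabla\cdot u=0,\qquad u(x,0)=u_0(x),$$ where $\int_\Omega u_0\,dx=0$, and suppose that $\|Du\|_\infty$ is bounded for all time. Then there exist positive constants $c_1$ and $c_2$, where $c_1$ and $c_2$ depend at most on $L$ (and not on $u$, $u_0$, $f$, $\nu$), such that the long-time averaged crest factor satisfies $$\langle C_f\rangle=\biggl\langle L^{3/2}\,\frac{\|u\|_\infty}{F_0^{1/2}}\biggr\rangle\le L^{3/2}\,c_2\,\lambda_0^{-3/4}\Bigl(c_1\,\nu^{-1}\,\bigl\langle\|Du\|_\infty\bigr\rangle+\lambda_0^{-2}\Bigr)^{3/8}.$$ Moreover, one can take $c_1=3$.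
   Context: All spatial norms are taken at fixed time $t$ and are therefore functions of $t$. For a scalar function $\phi$ on $\Omega$, $\|\phi\|_2=(\int_\Omega|\phi|^2dx)^{1/2}$ and $\|\phi\|_\infty=\sup_{x\in\Omega}|\phi|$. For the vector field $u$, $\|u\|_\infty=\max_{i}\|u_i\|_\infty$ and $\|Du\|_\infty=\max_{i,j}\|\partial u_i/\partial x_j\|_\infty$. For a multi-index $\vec n=(n_1,n_2,n_3)$ of non-negative integers, $D^{\vec n}=\partial^{n_1+n_2+n_3}/(\partial x_1^{n_1}\partial x_2^{n_2}\partial x_3^{n_3})$. For each integer $n\ge 0$ define $$J_n=\sum_{i=1}^3\ \sum_{n_1+n_2+n_3=n}\frac{n!}{n_1!\,n_2!\,n_3!}\|D^{\vec n}u_i\|_2^2,\qquad \Phi_n=\sum_{i=1}^3\ \sum_{n_1+n_2+n_3=n}\frac{n!}{n_1!\,n_2!\,n_3!}\|D^{\vec n}f_i\|_2^2,$$ and $$\tau=L^2\nu^{-1},\qquad F_n=J_n+\tau^2\Phi_n .$$ The smallest length scale $\lambda_f$ of the forcing and the length $\lambda_0$ are defined by $$\lambda_f^{-2}=\sup_{n\ge 0}\frac{\Phi_{n+1}}{\Phi_n},\qquad \lambda_0^{-2}=\lambda_f^{-2}+L^{-2}.$$ The crest factor of $u$ is $C_f=L^{3/2}\|u\|_\infty/F_0^{1/2}$ (a function of $t$). The long-time average of a function $\phi(t)$ is $$\langle\phi\rangle=\limsup_{t\to\infty}\frac1t\int_0^t\phi(s)\,ds .$$ *)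

theory Defs
  imports "HOL-Analysis.Analysis"
begin

text \<open>
  Functions on the periodic box are functions on all of \<open>real^3\<close> that are \<open>L\<close>-periodic in each
  coordinate; norms and means are taken over one period cell. The index type \<open>3\<close> has the elements
  \<open>1\<close>, \<open>2\<close> and \<open>3 = 0\<close>.
\<close>

definition torus_cell :: "real \<Rightarrow> (real^3) set" where
  "torus_cell L = cbox 0 (\<chi> i. L)"

definition periodic :: "real \<Rightarrow> (real^3 \<Rightarrow> 'a) \<Rightarrow> bool" where
  "periodic L g \<longleftrightarrow> (\<forall>j x. g (x + L *\<^sub>R axis j 1) = g x)"

text \<open>
  \<open>Ck_on\<close> is meant for sets on which derivatives relative to the set are unique, such as open sets
  and convex sets with nonempty interior. On \<open>UNIV \<times> {0..}\<close> it means \<open>C\<^sup>k\<close> up to the boundary, with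
  one-sided time derivatives at time \<open>0\<close>.
\<close>

primrec Ck_on :: "nat \<Rightarrow> 'a::euclidean_space set \<Rightarrow> ('a \<Rightarrow> 'b::real_normed_vector) \<Rightarrow> bool" where
  "Ck_on 0 S g \<longleftrightarrow> continuous_on S g"
| "Ck_on (Suc k) S g \<longleftrightarrow>
     g differentiable_on S \<and> (\<forall>v. Ck_on k S (\<lambda>x. frechet_derivative g (at x within S) v))"

definition smooth_on :: "'a::euclidean_space set \<Rightarrow> ('a \<Rightarrow> 'b::real_normed_vector) \<Rightarrow> bool" where
  "smooth_on S g \<longleftrightarrow> (\<forall>k. Ck_on k S g)"

definition pderiv_at :: "3 \<Rightarrow> (real^3 \<Rightarrow> real) \<Rightarrow> real^3 \<Rightarrow> real" where
  "pderiv_at j g x = deriv (\<lambda>s. g (x + s *\<^sub>R axis j 1)) 0"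

definition multi_deriv :: "nat \<times> nat \<times> nat \<Rightarrow> (real^3 \<Rightarrow> real) \<Rightarrow> real^3 \<Rightarrow> real" where
  "multi_deriv = (\<lambda>(n1, n2, n3) g.
     (pderiv_at 1 ^^ n1) ((pderiv_at 2 ^^ n2) ((pderiv_at 3 ^^ n3) g)))"

definition l2_norm :: "real \<Rightarrow> (real^3 \<Rightarrow> real) \<Rightarrow> real" where
  "l2_norm L g = sqrt (integral (torus_cell L) (\<lambda>x. \<bar>g x\<bar>\<^sup>2))"

definition sup_norm :: "real \<Rightarrow> (real^3 \<Rightarrow> real) \<Rightarrow> real" where
  "sup_norm L g = (SUP x\<in>torus_cell L. \<bar>g x\<bar>)"

definition vec_sup_norm :: "real \<Rightarrow> (real^3 \<Rightarrow> real^3) \<Rightarrow> real" where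
  "vec_sup_norm L v = (MAX i. sup_norm L (\<lambda>x. v x $ i))"

definition grad_sup_norm :: "real \<Rightarrow> (real^3 \<Rightarrow> real^3) \<Rightarrow> real" where
  "grad_sup_norm L v = (MAX (i, j). sup_norm L (pderiv_at j (\<lambda>x. v x $ i)))"

text \<open>Both \<open>J\<^sub>n\<close> and \<open>\<Phi>\<^sub>n\<close> are values of this functional: at the velocity \<open>u(\<cdot>,t)\<close> and at the
  forcing \<open>f\<close> respectively.\<close>

definition deriv_energy :: "real \<Rightarrow> nat \<Rightarrow> (real^3 \<Rightarrow> real^3) \<Rightarrow> real" where
  "deriv_energy L n v =
     (\<Sum>i\<in>UNIV. \<Sum>(n1, n2, n3) | n1 + n2 + n3 = n.
        fact n / (fact n1 * fact n2 * fact n3) *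
        (l2_norm L (multi_deriv (n1, n2, n3) (\<lambda>x. v x $ i)))\<^sup>2)"

definition visc_time :: "real \<Rightarrow> real \<Rightarrow> real" where
  "visc_time L \<nu> = L\<^sup>2 / \<nu>"

definition forced_energy ::
  "real \<Rightarrow> real \<Rightarrow> (real^3 \<Rightarrow> real^3) \<Rightarrow> nat \<Rightarrow> (real^3 \<Rightarrow> real^3) \<Rightarrow> real" where
  "forced_energy L \<nu> f n v = deriv_energy L n v + (visc_time L \<nu>)\<^sup>2 * deriv_energy L n f"

text \<open>
  The defining relations are \<open>\<lambda>\<^sub>f\<^sup>-\<^sup>2 = sup\<^sub>n \<Phi>\<^sub>n\<^sub>+\<^sub>1 / \<Phi>\<^sub>n\<close> and \<open>\<lambda>\<^sub>0\<^sup>-\<^sup>2 = \<lambda>\<^sub>f\<^sup>-\<^sup>2 + L\<^sup>-\<^sup>2\<close>. The real supremum is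
  only meaningful when the ratios are bounded above.
\<close>

definition forcing_length :: "real \<Rightarrow> (real^3 \<Rightarrow> real^3) \<Rightarrow> real" where
  "forcing_length L f = 1 / sqrt (SUP n. deriv_energy L (Suc n) f / deriv_energy L n f)"

definition length0 :: "real \<Rightarrow> (real^3 \<Rightarrow> real^3) \<Rightarrow> real" where
  "length0 L f = 1 / sqrt (forcing_length L f powi (-2) + L powi (-2))"

definition crest_factor :: "real \<Rightarrow> real \<Rightarrow> (real^3 \<Rightarrow> real^3) \<Rightarrow> (real^3 \<Rightarrow> real^3) \<Rightarrow> real" where
  "crest_factor L \<nu> f v = L powr (3/2) * vec_sup_norm L v / forced_energy L \<nu> f 0 v powr (1/2)"

definition time_average :: "(real \<Rightarrow> real) \<Rightarrow> ereal" where
  "time_average g = Limsup at_top (\<lambda>t. ereal (1 / t * integral {0..t} g))"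

text \<open>Only times \<open>t \<ge> 0\<close> are relevant for \<open>u\<close> and \<open>p\<close>.\<close>

definition smooth_periodic_NS_solution ::
  "real \<Rightarrow> real \<Rightarrow> (real^3 \<Rightarrow> real^3) \<Rightarrow> (real^3 \<Rightarrow> real^3) \<Rightarrow>
   (real \<Rightarrow> real^3 \<Rightarrow> real^3) \<Rightarrow> (real \<Rightarrow> real^3 \<Rightarrow> real) \<Rightarrow> bool" where
  "smooth_periodic_NS_solution L \<nu> f u0 u p \<longleftrightarrow>
     smooth_on (UNIV \<times> {0..}) (\<lambda>(x, t). u t x) \<and>
     smooth_on (UNIV \<times> {0..}) (\<lambda>(x, t). p t x) \<and>
     (\<forall>t\<ge>0. periodic L (u t) \<and> periodic L (p t)) \<and>
     (\<forall>t\<ge>0. \<forall>x i.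
        vector_derivative (\<lambda>s. u s x $ i) (at t within {0..})
          + (\<Sum>j\<in>UNIV. u t x $ j * pderiv_at j (\<lambda>y. u t y $ i) x)
        = \<nu> * (\<Sum>j\<in>UNIV. pderiv_at j (pderiv_at j (\<lambda>y. u t y $ i)) x)
          - pderiv_at i (p t) x + f x $ i) \<and>
     (\<forall>t\<ge>0. \<forall>x. (\<Sum>j\<in>UNIV. pderiv_at j (\<lambda>y. u t y $ j) x) = 0) \<and>
     (\<forall>x. u 0 x = u0 x)"

end

theory Submission
  imports Defs
begin

text \<open>
  The proof combines two rungs of the ladder of energies \<open>F\<^sub>n = J\<^sub>n + \<tau>\<^sup>2 \<Phi>\<^sub>n\<close> with Agmon's inequality.

  Testing the Navier-Stokes equations with \<open>u\<close> and with its Laplacian gives (\<open>energy_ladder_0\<close>,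
  \<open>energy_ladder_1\<close>)
  \<open>F\<^sub>0' / 2 \<le> - \<nu> F\<^sub>1 + \<nu> \<lambda>\<^sub>0\<^sup>-\<^sup>2 F\<^sub>0\<close> and
  \<open>F\<^sub>1' / 2 \<le> - \<nu> F\<^sub>2 + (3 \<parallel>Du\<parallel> + \<nu> \<lambda>\<^sub>0\<^sup>-\<^sup>2) F\<^sub>1\<close>,
  where the norm of the gradient is the supremum norm.
  The only term of the second balance that is not quadratic is the stretching term, a sum of products of
  three first derivatives; bounding one factor in each product by \<open>\<parallel>Du\<parallel>\<close> and pairing the other two
  produces the constant \<open>3\<close>.

  The contribution of the forcing keeps \<open>F\<^sub>0\<close> and \<open>F\<^sub>1\<close> above \<open>1\<close>. Dividing the two inequalities by \<open>F\<^sub>0\<close> and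
  \<open>F\<^sub>1\<close> and integrating the logarithmic derivatives therefore bounds the long-time means of \<open>F\<^sub>1 / F\<^sub>0\<close> by
  \<open>a = \<lambda>\<^sub>0\<^sup>-\<^sup>2\<close> and of \<open>F\<^sub>2 / F\<^sub>1\<close> by \<open>b = 3 \<nu>\<^sup>-\<^sup>1 \<langle>\<parallel>Du\<parallel>\<rangle> + \<lambda>\<^sub>0\<^sup>-\<^sup>2\<close> (\<open>mean_growth_rate_bound\<close>).

  A pointwise bound by the \<open>L\<^sup>2\<close> norms of a function and of its second derivatives
  (\<open>pointwise_bound_torus\<close>) gives \<open>C\<^sub>f \<le> K ((F\<^sub>2 / F\<^sub>0) powr (3/8) + 1)\<close> with \<open>K\<close> depending on \<open>L\<close> only
  (\<open>crest_factor_le\<close>). As \<open>F\<^sub>2 / F\<^sub>0\<close> is the product of the two ratios above, averaging bounds the mean of its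
  power by a multiple of \<open>(a b) powr (3/8)\<close> (\<open>crest_average_combination\<close>). The additive constant is
  harmless, because \<open>\<lambda>\<^sub>0\<^sup>-\<^sup>2 \<ge> L\<^sup>-\<^sup>2\<close> makes \<open>L powr (3/2) * (a b) powr (3/8)\<close> at least \<open>1\<close>.
\<close>

section \<open>Smoothness on space-time\<close>

abbreviation spacetime :: "((real^3) \<times> real) set" where
  "spacetime \<equiv> UNIV \<times> {0..}"

definition time_deriv :: "((real^3) \<times> real \<Rightarrow> real) \<Rightarrow> (real^3) \<times> real \<Rightarrow> real" where
  "time_deriv G = (\<lambda>(x, t). vector_derivative (\<lambda>s. G (x, s)) (at t within {0..}))"

text \<open>\<open>frechet_derivative\<close> selects some derivative, which need not be the only one on an arbitrary
  set. Functions that agree on the set have the same derivatives there, hence the same selection,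
  and this makes \<open>Ck_on\<close> a property of the values on \<open>S\<close>.\<close>

lemma frechet_derivative_within_cong:
  assumes "x \<in> S" "\<And>y. y \<in> S \<Longrightarrow> f y = g y"
  shows "frechet_derivative f (at x within S) = frechet_derivative g (at x within S)"
proof -
  have "(f has_derivative D) (at x within S) \<longleftrightarrow> (g has_derivative D) (at x within S)" for D
    using assms by (metis has_derivative_transform)
  then show ?thesis unfolding frechet_derivative_def by simp
qed

lemma Ck_on_cong:
  assumes "\<And>y. y \<in> S \<Longrightarrow> f y = g y"
  shows "Ck_on k S f \<longleftrightarrow> Ck_on k S g"
  using assms
proof (induction k arbitrary: f g)
  case 0
  then show ?case by (simp cong: continuous_on_cong)
next
  case (Suc k)
  have "f differentiable_on S \<longleftrightarrow> g differentiable_on S"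
    unfolding differentiable_on_def differentiable_def
    using Suc.prems by (metis has_derivative_transform)
  moreover have "Ck_on k S (\<lambda>x. frechet_derivative f (at x within S) v)
      \<longleftrightarrow> Ck_on k S (\<lambda>x. frechet_derivative g (at x within S) v)" for v
    by (rule Suc.IH) (metis frechet_derivative_within_cong Suc.prems)
  ultimately show ?case by simp
qed

lemma smooth_on_cong:
  assumes "smooth_on S f" "\<And>y. y \<in> S \<Longrightarrow> f y = g y"
  shows "smooth_on S g"
  using assms(1) Ck_on_cong[OF assms(2), of S] unfolding smooth_on_def by simp

lemma smooth_on_imp_continuous_on: "smooth_on S g \<Longrightarrow> continuous_on S g"
  unfolding smooth_on_def using Ck_on.simps(1) by blast

lemma smooth_on_has_derivative:
  assumes "smooth_on S g" "x \<in> S"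
  shows "(g has_derivative frechet_derivative g (at x within S)) (at x within S)"
proof -
  have "Ck_on (Suc 0) S g" using assms(1) unfolding smooth_on_def by blast
  then have "g differentiable (at x within S)" using assms(2) by (simp add: differentiable_on_def)
  then show ?thesis by (simp add: frechet_derivative_works)
qed

lemma smooth_on_directional_derivative:
  assumes "smooth_on S g"
  shows "smooth_on S (\<lambda>x. frechet_derivative g (at x within S) v)"
  unfolding smooth_on_def
proof
  fix k
  have "Ck_on (Suc k) S g" using assms unfolding smooth_on_def by blast
  then show "Ck_on k S (\<lambda>x. frechet_derivative g (at x within S) v)" by simp
qed

text \<open>A component of the selected derivative of \<open>g\<close> has to be the selected derivative of that component,
  which requires uniqueness of derivatives relative to \<open>S\<close>. The assumption \<open>fat\<close> says that \<open>S\<close> extends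
  along every coordinate axis through each of its points, and this determines a derivative.\<close>

lemma smooth_on_vec_nth:
  assumes "smooth_on S g"
    and fat: "\<And>x i e. \<lbrakk>x \<in> S; i \<in> Basis; e > 0\<rbrakk> \<Longrightarrow> \<exists>d. 0 < \<bar>d\<bar> \<and> \<bar>d\<bar> < e \<and> x + d *\<^sub>R i \<in> S"
  shows "smooth_on S (\<lambda>x. (g x :: real^3) $ i)"
proof -
  have "Ck_on k S (\<lambda>x. g x $ i)" if "Ck_on k S g" for k and g :: "'a \<Rightarrow> real^3"
    using that
  proof (induction k arbitrary: g)
    case 0
    then show ?case by (auto intro!: continuous_intros)
  next
    case (Suc k)
    have D: "(g has_derivative frechet_derivative g (at x within S)) (at x within S)"
      if "x \<in> S" for x
      using that Suc.prems by (simp add: differentiable_on_def frechet_derivative_works)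
    have Di: "((\<lambda>x. g x $ i) has_derivative (\<lambda>v. frechet_derivative g (at x within S) v $ i))
         (at x within S)" if "x \<in> S" for x
      using D[OF that] by (rule bounded_linear.has_derivative[OF bounded_linear_vec_nth])
    have eq: "frechet_derivative (\<lambda>x. g x $ i) (at x within S)
        = (\<lambda>v. frechet_derivative g (at x within S) v $ i)" if "x \<in> S" for x
    proof (rule frechet_derivative_unique_within[OF _ Di[OF that]])
      show "((\<lambda>x. g x $ i) has_derivative frechet_derivative (\<lambda>x. g x $ i) (at x within S))
          (at x within S)"
        using Di[OF that] by (metis differentiableI frechet_derivative_works)
    qed (use fat that in blast)
    have "Ck_on k S (\<lambda>x. frechet_derivative (\<lambda>x. g x $ i) (at x within S) v)" for v
    proof -
      have "Ck_on k S (\<lambda>x. frechet_derivative g (at x within S) v $ i)"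
        using Suc.prems by (intro Suc.IH) simp
      then show ?thesis
        by (subst Ck_on_cong[where g="\<lambda>x. frechet_derivative g (at x within S) v $ i"])
           (auto simp: eq)
    qed
    moreover have "(\<lambda>x. g x $ i) differentiable_on S"
      unfolding differentiable_on_def using Di by (blast intro: differentiableI)
    ultimately show ?case by simp
  qed
  then show ?thesis using assms(1) unfolding smooth_on_def by blast
qed

text \<open>On the boundary \<open>t = 0\<close> one steps forward in time.\<close>

lemma spacetime_fat:
  assumes "x \<in> spacetime" "i \<in> Basis" "e > 0"
  shows "\<exists>d. 0 < \<bar>d\<bar> \<and> \<bar>d\<bar> < e \<and> x + d *\<^sub>R i \<in> spacetime"
proof (intro exI[of _ "e/2"] conjI)
  have "snd i \<ge> 0" using assms(2) by (auto simp: Basis_prod_def)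
  then have "snd x + (e/2) * snd i \<ge> 0" using assms(1,3) by auto
  then show "x + (e/2) *\<^sub>R i \<in> spacetime" by (simp add: mem_Times_iff)
qed (use assms(3) in auto)

lemma smooth_on_spacetime_vec_nth:
  "smooth_on spacetime (\<lambda>(x, t). u t x) \<Longrightarrow> smooth_on spacetime (\<lambda>(x, t). (u t x :: real^3) $ i)"
  using smooth_on_vec_nth[of spacetime "\<lambda>(x, t). u t x" i] spacetime_fat
  by (simp add: case_prod_unfold)

lemma smooth_on_UNIV_vec_nth:
  "smooth_on UNIV g \<Longrightarrow> smooth_on UNIV (\<lambda>x. (g x :: real^3) $ i)"
  by (erule smooth_on_vec_nth) (rule_tac x="e/2" in exI, auto)

text \<open>A spatial direction \<open>(v, 0)\<close> stays in the half-space of times \<open>t \<ge> 0\<close>, so the chain rule gives the full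
  spatial derivative from any derivative relative to the half-space.\<close>

lemma smooth_on_slice_has_derivative:
  assumes "smooth_on spacetime G" "t \<ge> 0"
  shows "((\<lambda>x. G (x, t)) has_derivative (\<lambda>v. frechet_derivative G (at (x, t) within spacetime) (v, 0)))
    (at x)"
proof -
  let ?D = "frechet_derivative G (at (x, t) within spacetime)"
  have D: "(G has_derivative ?D) (at (x, t) within spacetime)"
    using assms by (intro smooth_on_has_derivative) auto
  have "((G \<circ> (\<lambda>y. (y, t))) has_derivative (?D \<circ> (\<lambda>v. (v, 0)))) (at x within UNIV)"
    using assms(2)
    by (intro diff_chain_within has_derivative_subset[OF D])
       (auto intro!: derivative_eq_intros)
  then show ?thesis by (simp add: o_def)
qed

lemma smooth_on_slice:
  assumes "smooth_on spacetime G" "t \<ge> 0"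
  shows "smooth_on UNIV (\<lambda>x. G (x, t))"
proof -
  have "Ck_on k UNIV (\<lambda>x. G (x, t))" for k
    using assms(1)
  proof (induction k arbitrary: G)
    case 0
    then have "continuous_on spacetime G" by (rule smooth_on_imp_continuous_on)
    then show ?case using assms(2)
      by (auto intro!: continuous_on_compose2[of spacetime G] continuous_intros)
  next
    case (Suc k)
    note D = smooth_on_slice_has_derivative[OF Suc.prems assms(2)]
    have "frechet_derivative (\<lambda>x. G (x, t)) (at x) v
        = frechet_derivative G (at (x, t) within spacetime) (v, 0)" for x v
      using frechet_derivative_at[OF D] by metis
    moreover have "Ck_on k UNIV (\<lambda>x. frechet_derivative G (at (x, t) within spacetime) (v, 0))" for v
      by (rule Suc.IH[OF smooth_on_directional_derivative[OF Suc.prems]])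
    moreover have "(\<lambda>x. G (x, t)) differentiable_on UNIV"
      unfolding differentiable_on_def using differentiableI[OF D] by simp
    ultimately show ?case by simp
  qed
  then show ?thesis unfolding smooth_on_def by blast
qed

section \<open>Partial derivatives of smooth functions\<close>

lemma has_derivative_pderiv_at:
  assumes "(g has_derivative D) (at x)"
  shows "((\<lambda>s. g (x + s *\<^sub>R axis j 1)) has_field_derivative D (axis j 1)) (at 0)"
    and "pderiv_at j g x = D (axis j 1)"
proof -
  have "((\<lambda>s. x + s *\<^sub>R axis j (1::real)) has_derivative (\<lambda>s. s *\<^sub>R axis j 1)) (at 0)"
    by (auto intro!: derivative_eq_intros)
  from diff_chain_at[OF this, of g D]
  have "((\<lambda>s. g (x + s *\<^sub>R axis j 1)) has_derivative (\<lambda>s. D (s *\<^sub>R axis j 1))) (at 0)"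
    using assms by (simp add: o_def)
  then show *: "((\<lambda>s. g (x + s *\<^sub>R axis j 1)) has_field_derivative D (axis j 1)) (at 0)"
    unfolding has_field_derivative_def
    using has_derivative_linear[OF assms] by (simp add: linear_cmul mult_commute_abs)
  show "pderiv_at j g x = D (axis j 1)"
    unfolding pderiv_at_def by (rule DERIV_imp_deriv[OF *])
qed

lemma has_derivative_sum_pderiv_at:
  assumes "smooth_on UNIV g"
  shows "(g has_derivative (\<lambda>v. \<Sum>j\<in>UNIV. v $ j * pderiv_at j g x)) (at x)"
proof -
  let ?D = "frechet_derivative g (at x)"
  have D: "(g has_derivative ?D) (at x)"
    using smooth_on_has_derivative[OF assms, of x] by simp
  have "?D v = (\<Sum>j\<in>UNIV. v $ j * pderiv_at j g x)" for v
  proof -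
    have lin: "linear ?D" using D by (rule has_derivative_linear)
    have "?D v = ?D (\<Sum>j\<in>UNIV. v $ j *\<^sub>R axis j 1)"
      by (simp only: basis_expansion flip: scalar_mult_eq_scaleR)
    also have "\<dots> = (\<Sum>j\<in>UNIV. v $ j * ?D (axis j 1))"
      by (simp add: linear_sum[OF lin] linear_cmul[OF lin])
    finally show ?thesis by (simp add: has_derivative_pderiv_at(2)[OF D])
  qed
  then have "?D = (\<lambda>v. \<Sum>j\<in>UNIV. v $ j * pderiv_at j g x)" by auto
  then show ?thesis using D by simp
qed

lemma smooth_on_pderiv_at:
  assumes "smooth_on UNIV g"
  shows "smooth_on UNIV (pderiv_at j g)"
proof (rule smooth_on_cong[OF smooth_on_directional_derivative[OF assms, of "axis j 1"]])
  fix x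
  show "frechet_derivative g (at x) (axis j 1) = pderiv_at j g x"
    using has_derivative_pderiv_at(2)[OF smooth_on_has_derivative[OF assms UNIV_I], of j x] by simp
qed

lemma pderiv_at_line:
  assumes "smooth_on UNIV g"
  shows "((\<lambda>s. g (x + s *\<^sub>R axis j 1)) has_field_derivative pderiv_at j g (x + s *\<^sub>R axis j 1)) (at s)"
proof -
  have "((\<lambda>r. g ((x + s *\<^sub>R axis j 1) + r *\<^sub>R axis j 1)) has_field_derivative
      pderiv_at j g (x + s *\<^sub>R axis j 1)) (at 0)"
    using has_derivative_pderiv_at[OF has_derivative_sum_pderiv_at[OF assms, of "x + s *\<^sub>R axis j 1"], of j]
    by simp
  then have "((\<lambda>r. g (x + (r + s) *\<^sub>R axis j 1)) has_field_derivative
      pderiv_at j g (x + s *\<^sub>R axis j 1)) (at 0)"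
    by (simp add: scaleR_left_distrib add_ac)
  then show ?thesis
    using DERIV_shift[of "\<lambda>s. g (x + s *\<^sub>R axis j 1)" "pderiv_at j g (x + s *\<^sub>R axis j 1)" 0 s]
    by simp
qed

lemma periodic_pderiv_at:
  assumes "periodic L g"
  shows "periodic L (pderiv_at j g)"
proof -
  have "g (x + L *\<^sub>R axis i 1 + s *\<^sub>R axis j 1) = g (x + s *\<^sub>R axis j 1)" for x i s
    using assms[unfolded periodic_def, rule_format, of "x + s *\<^sub>R axis j 1" i] by (simp add: add_ac)
  then show ?thesis unfolding periodic_def pderiv_at_def by simp
qed

section \<open>Symmetry of mixed derivatives\<close>

text \<open>Write \<open>\<phi> c y = \<phi> a0 y + \<integral> P s y ds\<close> over \<open>s \<in> {a0..c}\<close>, differentiate under the integral sign in \<open>y\<close>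
  at \<open>b\<close>, and then differentiate the result in \<open>c\<close> at \<open>a\<close>. The argument is one-sided
  in the second variable, so \<open>b\<close> may be an endpoint of \<open>B\<close>, such as the initial time.\<close>

lemma symmetric_mixed_derivative:
  fixes \<phi> :: "real \<Rightarrow> real \<Rightarrow> real"
  assumes P: "\<And>a b. b \<in> B \<Longrightarrow> ((\<lambda>a. \<phi> a b) has_field_derivative P a b) (at a)"
    and Q: "\<And>a b. b \<in> B \<Longrightarrow> (\<phi> a has_field_derivative Q a b) (at b within B)"
    and R: "\<And>a b. b \<in> B \<Longrightarrow> (P a has_field_derivative R a b) (at b within B)"
    and contP: "\<And>b. b \<in> B \<Longrightarrow> continuous_on UNIV (\<lambda>a. P a b)"
    and contR: "continuous_on (UNIV \<times> B) (\<lambda>(a, b). R a b)"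
    and B: "convex B" "at b within B \<noteq> bot" "b \<in> B"
  shows "((\<lambda>a. Q a b) has_field_derivative R a b) (at a)"
proof -
  \<comment> \<open>any base point to the left of \<open>a\<close>\<close>
  define a0 where "a0 = a - 1"
  have int: "\<phi> c y = \<phi> a0 y + integral {a0..c} (\<lambda>s. P s y)" if "y \<in> B" "a0 \<le> c" for c y
  proof -
    have "((\<lambda>s. P s y) has_integral (\<phi> c y - \<phi> a0 y)) {a0..c}"
      using that P[OF that(1)]
      by (intro fundamental_theorem_of_calculus)
         (auto simp: has_real_derivative_iff_has_vector_derivative[symmetric]
               intro: has_field_derivative_at_within)
    then show ?thesis by (simp add: integral_unique)
  qed
  have Qint: "Q c b = Q a0 b + integral {a0..c} (\<lambda>s. R s b)" if c: "a0 \<le> c" for c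
  proof -
    have "((\<lambda>y. integral (cbox a0 c) (\<lambda>s. P s y)) has_field_derivative integral (cbox a0 c) (\<lambda>s. R s b))
      (at b within B)"
    proof (rule leibniz_rule_field_derivative)
      show "continuous_on (B \<times> cbox a0 c) (\<lambda>(y, s). R s y)"
        unfolding case_prod_unfold
        by (rule continuous_on_compose2[OF contR, of _ "\<lambda>z. (snd z, fst z)", simplified])
           (auto intro!: continuous_intros)
      show "(\<lambda>s. P s y) integrable_on cbox a0 c" if "y \<in> B" for y
        by (rule integrable_continuous) (rule continuous_on_subset[OF contP[OF that]], simp)
    qed (use R B in auto)
    then have "((\<lambda>y. \<phi> a0 y + integral {a0..c} (\<lambda>s. P s y)) has_field_derivative
        (Q a0 b + integral {a0..c} (\<lambda>s. R s b))) (at b within B)"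
      using Q[OF B(3), of a0] by (auto intro: DERIV_add)
    then have "(\<phi> c has_field_derivative (Q a0 b + integral {a0..c} (\<lambda>s. R s b))) (at b within B)"
      unfolding has_field_derivative_def
      by (rule has_derivative_transform[OF B(3) int[OF _ c], rotated])
    then show ?thesis
      by (rule has_field_derivative_unique[OF Q[OF B(3)] _ B(2)])
  qed
  have "((\<lambda>c. integral {a0..c} (\<lambda>s. R s b)) has_real_derivative R a b) (at a within {a0..a+1})"
  proof (rule integral_has_real_derivative)
    show "continuous_on {a0..a+1} (\<lambda>s. R s b)"
      using B(3) by (intro continuous_on_compose2[OF contR, of _ "\<lambda>s. (s, b)", simplified])
         (auto intro!: continuous_intros)
  qed (auto simp: a0_def)
  then have "((\<lambda>c. integral {a0..c} (\<lambda>s. R s b)) has_real_derivative R a b) (at a)"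
    by (simp add: at_within_Icc_at a0_def)
  then have "((\<lambda>c. Q a0 b + integral {a0..c} (\<lambda>s. R s b)) has_real_derivative R a b) (at a)"
    by (auto intro!: derivative_eq_intros)
  then show ?thesis
    by (rule has_field_derivative_transform_within_open[of _ _ _ "{a0<..}", OF _ _ _ Qint[symmetric]])
       (auto simp: a0_def)
qed

lemma pderiv_at_commute:
  assumes "smooth_on UNIV g"
  shows "pderiv_at j (pderiv_at k g) x = pderiv_at k (pderiv_at j g) x"
proof -
  let ?p = "\<lambda>a b. x + a *\<^sub>R axis j (1::real) + b *\<^sub>R axis k 1"
  have p: "?p a b = x + b *\<^sub>R axis k 1 + a *\<^sub>R axis j (1::real)" for a b by (simp add: algebra_simps)
  have cont: "continuous_on A (\<lambda>z. h (?p (f1 z) (f2 z)))"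
    if "smooth_on UNIV h" "continuous_on A f1" "continuous_on A f2"
    for h and A :: "'b::topological_space set" and f1 f2
    using that by (intro continuous_on_compose2[OF smooth_on_imp_continuous_on[OF that(1)]] continuous_intros) auto
  have "((\<lambda>a. pderiv_at k g (?p a 0)) has_field_derivative pderiv_at k (pderiv_at j g) (?p 0 0)) (at 0)"
  proof (rule symmetric_mixed_derivative[where B=UNIV and \<phi>="\<lambda>a b. g (?p a b)"
         and P="\<lambda>a b. pderiv_at j g (?p a b)" and Q="\<lambda>a b. pderiv_at k g (?p a b)"
         and R="\<lambda>a b. pderiv_at k (pderiv_at j g) (?p a b)" and a=0 and b=0])
    show "((\<lambda>a. g (?p a b)) has_field_derivative pderiv_at j g (?p a b)) (at a)" for a b
      unfolding p by (rule pderiv_at_line[OF assms])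
    show "continuous_on (UNIV \<times> UNIV) (\<lambda>(a, b). pderiv_at k (pderiv_at j g) (?p a b))"
      unfolding case_prod_unfold
      by (intro cont smooth_on_pderiv_at assms continuous_intros)
    show "continuous_on UNIV (\<lambda>a. pderiv_at j g (?p a b))" for b
      by (intro cont smooth_on_pderiv_at assms continuous_intros)
    show "((\<lambda>b. g (?p a b)) has_field_derivative pderiv_at k g (?p a b)) (at b)" for a b
      by (rule pderiv_at_line[OF assms])
    show "((\<lambda>b. pderiv_at j g (?p a b)) has_field_derivative pderiv_at k (pderiv_at j g) (?p a b)) (at b)"
      for a b
      by (rule pderiv_at_line[OF smooth_on_pderiv_at[OF assms]])
  qed auto
  then show ?thesis unfolding pderiv_at_def[of j "pderiv_at k g"]
    by (simp add: DERIV_imp_deriv)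
qed

section \<open>Space and time derivatives on space-time\<close>

lemma smooth_on_spacetime_pderiv:
  assumes "smooth_on spacetime G"
  shows "smooth_on spacetime (\<lambda>(x, t). pderiv_at j (\<lambda>y. G (y, t)) x)"
proof (rule smooth_on_cong[OF smooth_on_directional_derivative[OF assms, of "(axis j 1, 0)"]])
  fix z assume "z \<in> spacetime"
  then show "frechet_derivative G (at z within spacetime) (axis j 1, 0)
      = (case z of (x, t) \<Rightarrow> pderiv_at j (\<lambda>y. G (y, t)) x)"
    using has_derivative_pderiv_at(2)[OF smooth_on_slice_has_derivative[OF assms, of "snd z" "fst z"], of j]
    by (auto simp: case_prod_unfold)
qed

lemma smooth_on_time_has_vector_derivative:
  assumes "smooth_on spacetime G" "t \<ge> 0"
  shows "((\<lambda>s. G (x, s)) has_vector_derivative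
      frechet_derivative G (at (x, t) within spacetime) (0, 1)) (at t within {0..})"
proof -
  let ?D = "frechet_derivative G (at (x, t) within spacetime)"
  have D: "(G has_derivative ?D) (at (x, t) within spacetime)"
    using assms by (intro smooth_on_has_derivative) auto
  have "((G \<circ> (\<lambda>s. (x, s))) has_derivative (?D \<circ> (\<lambda>v. (0, v)))) (at t within {0..})"
    by (intro diff_chain_within has_derivative_subset[OF D])
       (auto intro!: derivative_eq_intros)
  moreover have "?D \<circ> (\<lambda>v. (0, v)) = (\<lambda>v. v *\<^sub>R ?D (0, 1))"
  proof
    fix v :: real
    show "(?D \<circ> (\<lambda>v. (0, v))) v = v *\<^sub>R ?D (0, 1)"
      using linear_cmul[OF has_derivative_linear[OF D], of v "(0, 1)"] by simp
  qed
  ultimately show ?thesis by (simp add: o_def[of G] has_vector_derivative_def)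
qed

lemma at_within_atLeast_nontrivial: "(0::real) \<le> t \<Longrightarrow> at t within {0..} \<noteq> bot"
proof -
  assume "0 \<le> t"
  then have "at_right t \<le> at t within {0..}" by (intro at_le) auto
  then show ?thesis using trivial_limit_at_right_real[of t] by (metis bot_unique)
qed

lemma time_deriv_eq:
  assumes "smooth_on spacetime G" "t \<ge> 0"
  shows "time_deriv G (x, t) = frechet_derivative G (at (x, t) within spacetime) (0, 1)"
  unfolding time_deriv_def prod.case
  by (rule vector_derivative_within[OF at_within_atLeast_nontrivial[OF assms(2)] smooth_on_time_has_vector_derivative[OF assms]])

lemma has_field_derivative_time_deriv:
  assumes "smooth_on spacetime G" "t \<ge> 0"
  shows "((\<lambda>s. G (x, s)) has_field_derivative time_deriv G (x, t)) (at t within {0..})"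
  unfolding time_deriv_eq[OF assms] has_real_derivative_iff_has_vector_derivative
  by (rule smooth_on_time_has_vector_derivative[OF assms])

lemma smooth_on_time_deriv:
  assumes "smooth_on spacetime G"
  shows "smooth_on spacetime (time_deriv G)"
  by (rule smooth_on_cong[OF smooth_on_directional_derivative[OF assms, of "(0, 1)"]])
     (metis SigmaE atLeast_iff time_deriv_eq[OF assms])

text \<open>This allows the time derivative of the enstrophy to be expressed by the gradient of \<open>u\<^sub>t\<close>, for
  which the momentum equation is available.\<close>

lemma time_deriv_pderiv_commute:
  assumes "smooth_on spacetime G" "t \<ge> 0"
  shows "time_deriv (\<lambda>(x, t). pderiv_at j (\<lambda>y. G (y, t)) x) (x, t)
    = pderiv_at j (\<lambda>y. time_deriv G (y, t)) x"
proof -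
  let ?H = "\<lambda>(x, t). pderiv_at j (\<lambda>y. G (y, t)) x"
  have H: "smooth_on spacetime ?H" by (rule smooth_on_spacetime_pderiv[OF assms(1)])
  have cont: "continuous_on A (\<lambda>z. h (x + f1 z *\<^sub>R axis j 1, f2 z))"
    if "smooth_on spacetime h" "continuous_on A f1" "continuous_on A f2" "\<And>z. z \<in> A \<Longrightarrow> f2 z \<ge> 0"
    for h :: "(real^3) \<times> real \<Rightarrow> real" and A :: "'b::topological_space set" and f1 f2
    using that by (intro continuous_on_compose2[OF smooth_on_imp_continuous_on[OF that(1)]] continuous_intros) auto
  have "((\<lambda>a. time_deriv G (x + a *\<^sub>R axis j 1, t)) has_field_derivative time_deriv ?H (x + 0 *\<^sub>R axis j 1, t)) (at 0)"
  proof (rule symmetric_mixed_derivative[where B="{0..}" and \<phi>="\<lambda>a b. G (x + a *\<^sub>R axis j 1, b)"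
         and P="\<lambda>a b. ?H (x + a *\<^sub>R axis j 1, b)"
         and Q="\<lambda>a b. time_deriv G (x + a *\<^sub>R axis j 1, b)"
         and R="\<lambda>a b. time_deriv ?H (x + a *\<^sub>R axis j 1, b)" and a = 0 and b = t])
    show "((\<lambda>a. G (x + a *\<^sub>R axis j 1, b)) has_field_derivative ?H (x + a *\<^sub>R axis j 1, b)) (at a)"
      if "b \<in> {0..}" for a b
      using pderiv_at_line[OF smooth_on_slice[OF assms(1)], of b x j a] that by simp
    show "continuous_on (UNIV \<times> {0..}) (\<lambda>(a, b). time_deriv ?H (x + a *\<^sub>R axis j 1, b))"
      using cont[OF smooth_on_time_deriv[OF H], of "UNIV \<times> {0..}" fst snd]
      by (simp add: case_prod_unfold continuous_on_fst continuous_on_snd continuous_on_id mem_Times_iff)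
    show "continuous_on UNIV (\<lambda>a. ?H (x + a *\<^sub>R axis j 1, b))" if "b \<in> {0..}" for b
      using cont[OF H, of UNIV "\<lambda>a. a" "\<lambda>_. b"] that by (simp add: continuous_on_id)
    show "((\<lambda>b. G (x + a *\<^sub>R axis j 1, b)) has_field_derivative time_deriv G (x + a *\<^sub>R axis j 1, b))
      (at b within {0..})" if "b \<in> {0..}" for a b
      using that by (intro has_field_derivative_time_deriv assms(1)) simp
    show "((\<lambda>b. ?H (x + a *\<^sub>R axis j 1, b)) has_field_derivative time_deriv ?H (x + a *\<^sub>R axis j 1, b))
      (at b within {0..})" if "b \<in> {0..}" for a b
      using that by (intro has_field_derivative_time_deriv H) simp
  qed (use assms at_within_atLeast_nontrivial in auto)
  from DERIV_imp_deriv[OF this]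
  have "deriv (\<lambda>a. time_deriv G (x + a *\<^sub>R axis j 1, t)) 0 = time_deriv ?H (x, t)"
    by (simp only: scaleR_zero_left add_0_right)
  then show ?thesis unfolding pderiv_at_def[of j "\<lambda>y. time_deriv G (y, t)"] by (rule sym)
qed

section \<open>Integration over a period cell\<close>

abbreviation cell_integral :: "real \<Rightarrow> (real^3 \<Rightarrow> real) \<Rightarrow> real" where
  "cell_integral L \<equiv> integral (torus_cell L)"

lemma continuous_integrable_on_cell:
  "continuous_on UNIV (g :: real^3 \<Rightarrow> real) \<Longrightarrow> g integrable_on torus_cell L"
  unfolding torus_cell_def by (rule integrable_continuous) (erule continuous_on_subset, simp)

lemma integral_translate_cbox:
  fixes f :: "real^3 \<Rightarrow> real"
  assumes "continuous_on UNIV f"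
  shows "integral (cbox a b) (\<lambda>x. f (x + c)) = integral (cbox (a + c) (b + c)) f"
proof -
  have "f integrable_on cbox (a + c) (b + c)"
    by (rule integrable_continuous) (rule continuous_on_subset[OF assms], simp)
  from has_integral_affinity[OF integrable_integral[OF this], of 1 c]
  have "((\<lambda>x. f (x + c)) has_integral integral (cbox (a + c) (b + c)) f)
      ((\<lambda>x. x + - c) ` cbox (a + c) (b + c))" by simp
  moreover have "(\<lambda>x. x + - c) ` cbox (a + c) (b + c) = cbox a b"
    using cbox_translation[of "- c" "a + c" "b + c"] by (simp add: add.commute)
  ultimately show ?thesis by (simp add: integral_unique)
qed

text \<open>A hyperplane cuts the cell, and another one cuts the translated cell, into two boxes each: one box is
  common to both cells and the two others differ by a translation by one period.\<close>

lemma cell_integral_translate: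
  assumes "continuous_on UNIV g" "periodic L g" "0 \<le> s" "s \<le> L"
  shows "cell_integral L (\<lambda>x. g (x + s *\<^sub>R axis j 1)) = cell_integral L g"
proof -
  let ?e = "axis j (1::real)" and ?c = "(\<chi> i. L) :: real^3"
  have int: "g integrable_on cbox a b" for a b
    by (rule integrable_continuous) (rule continuous_on_subset[OF assms(1)], simp)
  have comp: "?e $ i = (if i = j then 1 else 0)" for i by (simp add: axis_def)
  have mem: "x \<in> cbox a b \<longleftrightarrow> (a $ j \<le> x $ j \<and> x $ j \<le> b $ j) \<and>
      (\<forall>i. i \<noteq> j \<longrightarrow> a $ i \<le> x $ i \<and> x $ i \<le> b $ i)" for x a b :: "real^3"
    unfolding mem_box_cart by metis
  have 1: "cbox (s *\<^sub>R ?e) (?c + s *\<^sub>R ?e) \<inter> {x. x \<bullet> ?e \<le> L} = cbox (s *\<^sub>R ?e) ?c"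
   and 2: "cbox (s *\<^sub>R ?e) (?c + s *\<^sub>R ?e) \<inter> {x. x \<bullet> ?e \<ge> L} = cbox (L *\<^sub>R ?e) (?c + s *\<^sub>R ?e)"
   and 3: "cbox 0 ?c \<inter> {x. x \<bullet> ?e \<ge> s} = cbox (s *\<^sub>R ?e) ?c"
   and 4: "cbox 0 ?c \<inter> {x. x \<bullet> ?e \<le> s} = cbox 0 (?c - (L - s) *\<^sub>R ?e)"
    using assms(3,4)
    by (auto simp: set_eq_iff mem comp inner_axis)
  have "cell_integral L (\<lambda>x. g (x + s *\<^sub>R ?e)) = integral (cbox (s *\<^sub>R ?e) (?c + s *\<^sub>R ?e)) g"
    unfolding torus_cell_def by (simp add: integral_translate_cbox[OF assms(1)])
  also have "\<dots> = integral (cbox (s *\<^sub>R ?e) ?c) g + integral (cbox (L *\<^sub>R ?e) (?c + s *\<^sub>R ?e)) g"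
    using integral_split[OF int, of ?e "s *\<^sub>R ?e" "?c + s *\<^sub>R ?e" L] 1 2 by simp
  also have "integral (cbox (L *\<^sub>R ?e) (?c + s *\<^sub>R ?e)) g
      = integral (cbox 0 (?c - (L - s) *\<^sub>R ?e)) (\<lambda>x. g (x + L *\<^sub>R ?e))"
    by (simp add: integral_translate_cbox[OF assms(1)] algebra_simps)
  also have "\<dots> = integral (cbox 0 (?c - (L - s) *\<^sub>R ?e)) g"
    using assms(2) by (simp add: periodic_def)
  also have "integral (cbox (s *\<^sub>R ?e) ?c) g + \<dots> = cell_integral L g"
    using integral_split[OF int, of ?e 0 ?c s] 3 4 unfolding torus_cell_def by simp
  finally show ?thesis .
qed

text \<open>A periodic \<open>C\<^sup>1\<close> function in the direction \<open>j\<close> together with its derivative. Carrying the derivative along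
  makes the notion closed under products, so that products of smooth functions can be integrated by
  parts without a product rule for \<open>smooth_on\<close>.\<close>

definition torus_deriv :: "real \<Rightarrow> 3 \<Rightarrow> (real^3 \<Rightarrow> real) \<Rightarrow> (real^3 \<Rightarrow> real) \<Rightarrow> bool" where
  "torus_deriv L j g g' \<longleftrightarrow> periodic L g \<and> periodic L g' \<and> continuous_on UNIV g \<and>
     continuous_on UNIV g' \<and> (\<forall>x s. ((\<lambda>s. g (x + s *\<^sub>R axis j 1)) has_field_derivative
        g' (x + s *\<^sub>R axis j 1)) (at s))"

lemma torus_deriv_smooth:
  assumes "smooth_on UNIV g" "periodic L g"
  shows "torus_deriv L j g (pderiv_at j g)"
  unfolding torus_deriv_def
  using assms pderiv_at_line periodic_pderiv_at smooth_on_pderiv_at smooth_on_imp_continuous_on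
  by blast

lemma torus_deriv_mult:
  assumes "torus_deriv L j g g'" "torus_deriv L j h h'"
  shows "torus_deriv L j (\<lambda>x. g x * h x) (\<lambda>x. g' x * h x + g x * h' x)"
  using assms unfolding torus_deriv_def
  by (auto simp: periodic_def intro!: continuous_intros derivative_eq_intros)

text \<open>The cell integral of \<open>q'\<close> does not change when \<open>q'\<close> is translated along \<open>axis j 1\<close>. Averaging it over all
  translations by \<open>s \<in> {0..L}\<close> and exchanging the integrals leaves the increments of \<open>q\<close> over one period,
  which vanish.\<close>

lemma cell_integral_torus_deriv:
  assumes L: "L > 0" and "torus_deriv L j q q'"
  shows "cell_integral L q' = 0"
proof -
  let ?e = "axis j (1::real)" and ?c = "(\<chi> i. L) :: real^3"
  have per: "periodic L q" "periodic L q'" and cont: "continuous_on UNIV q'"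
    and der: "((\<lambda>s. q (x + s *\<^sub>R ?e)) has_field_derivative q' (x + s *\<^sub>R ?e)) (at s)" for x s
    using assms(2) by (auto simp: torus_deriv_def)
  have "L * cell_integral L q' = integral (cbox 0 L) (\<lambda>s. cell_integral L q')"
    using L by simp
  also have "\<dots> = integral (cbox 0 L) (\<lambda>s. integral (cbox 0 ?c) (\<lambda>x. q' (x + s *\<^sub>R ?e)))"
    by (rule integral_cong)
       (use cell_integral_translate[OF cont per(2)] in \<open>simp add: torus_cell_def\<close>)
  also have "\<dots> = integral (cbox 0 ?c) (\<lambda>x. integral (cbox 0 L) (\<lambda>s. q' (x + s *\<^sub>R ?e)))"
    by (rule integral_swap_continuous)
       (auto simp: case_prod_unfold intro!: continuous_on_compose2[OF cont] continuous_intros)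
  also have "\<dots> = integral (cbox 0 ?c) (\<lambda>x. 0)"
  proof (rule integral_cong)
    fix x
    have "((\<lambda>s. q' (x + s *\<^sub>R ?e)) has_integral (q (x + L *\<^sub>R ?e) - q (x + 0 *\<^sub>R ?e))) {0..L}"
      using L der
      by (intro fundamental_theorem_of_calculus)
         (auto simp: has_real_derivative_iff_has_vector_derivative[symmetric]
               intro: has_field_derivative_at_within)
    then show "integral (cbox 0 L) (\<lambda>s. q' (x + s *\<^sub>R ?e)) = 0"
      using per(1) by (simp add: periodic_def integral_unique)
  qed
  finally show ?thesis using L by simp
qed

lemma integration_by_parts_torus:
  assumes L: "L > 0" and g: "torus_deriv L j g g'" and h: "torus_deriv L j h h'"
  shows "cell_integral L (\<lambda>x. g x * h' x) = - cell_integral L (\<lambda>x. g' x * h x)"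
proof -
  have "0 = cell_integral L (\<lambda>x. g' x * h x + g x * h' x)"
    using cell_integral_torus_deriv[OF L torus_deriv_mult[OF g h]] by simp
  also have "\<dots> = cell_integral L (\<lambda>x. g' x * h x) + cell_integral L (\<lambda>x. g x * h' x)"
    using g h by (intro integral_add continuous_integrable_on_cell continuous_intros)
       (auto simp: torus_deriv_def)
  finally show ?thesis by simp
qed

lemma cell_integral_sum:
  assumes "\<And>k. continuous_on UNIV (g k)"
  shows "cell_integral L (\<lambda>x. \<Sum>k\<in>A. g k x) = (\<Sum>k\<in>A. cell_integral L (g k))"
proof (cases "finite A")
  case True
  then show ?thesis by (intro integral_sum continuous_integrable_on_cell assms)
qed simp

lemma divergence_free_pderiv_at:
  fixes w :: "3 \<Rightarrow> real^3 \<Rightarrow> real"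
  assumes w: "\<And>i. smooth_on UNIV (w i)" and div: "\<And>x. (\<Sum>i\<in>UNIV. pderiv_at i (w i) x) = 0"
  shows "(\<Sum>i\<in>UNIV. pderiv_at i (pderiv_at j (w i)) x) = 0"
proof -
  have "((\<lambda>s. \<Sum>i\<in>UNIV. pderiv_at i (w i) (x + s *\<^sub>R axis j 1)) has_field_derivative
      (\<Sum>i\<in>UNIV. pderiv_at j (pderiv_at i (w i)) (x + 0 *\<^sub>R axis j 1))) (at 0)"
    by (intro DERIV_sum pderiv_at_line smooth_on_pderiv_at w)
  then have "((\<lambda>s::real. 0) has_field_derivative
      (\<Sum>i\<in>UNIV. pderiv_at j (pderiv_at i (w i)) x)) (at 0)"
    by (simp only: div scaleR_zero_left add_0_right)
  then have "(\<Sum>i\<in>UNIV. pderiv_at j (pderiv_at i (w i)) x) = 0"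
    by (rule DERIV_unique) simp
  then show ?thesis by (simp add: pderiv_at_commute[OF w])
qed

text \<open>With \<open>q\<close> the pressure this removes the pressure from the energy balance; with \<open>q = h\<^sup>2\<close> it shows below that
  transport by a divergence-free field conserves \<open>\<integral> h\<^sup>2\<close>.\<close>

lemma divergence_free_orthogonal_gradient:
  fixes w :: "3 \<Rightarrow> real^3 \<Rightarrow> real"
  assumes L: "L > 0" and w: "\<And>i. smooth_on UNIV (w i)" "\<And>i. periodic L (w i)"
    and div: "\<And>x. (\<Sum>i\<in>UNIV. pderiv_at i (w i) x) = 0"
    and q: "\<And>i. torus_deriv L i q (q' i)"
  shows "(\<Sum>i\<in>UNIV. cell_integral L (\<lambda>x. w i x * q' i x)) = 0"
proof -
  have cq: "continuous_on UNIV q" using q by (simp add: torus_deriv_def)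
  have "(\<Sum>i\<in>UNIV. cell_integral L (\<lambda>x. w i x * q' i x))
      = - (\<Sum>i\<in>UNIV. cell_integral L (\<lambda>x. pderiv_at i (w i) x * q x))"
    unfolding sum_negf[symmetric]
    by (intro sum.cong refl integration_by_parts_torus[OF L torus_deriv_smooth q] w)
  also have "(\<Sum>i\<in>UNIV. cell_integral L (\<lambda>x. pderiv_at i (w i) x * q x))
      = cell_integral L (\<lambda>x. (\<Sum>i\<in>UNIV. pderiv_at i (w i) x * q x))"
    by (intro cell_integral_sum[symmetric] continuous_intros cq smooth_on_imp_continuous_on smooth_on_pderiv_at w)
  also have "\<dots> = 0" by (simp add: sum_distrib_right[symmetric] div)
  finally show ?thesis by simp
qed

lemma transport_cancels:
  fixes w :: "3 \<Rightarrow> real^3 \<Rightarrow> real"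
  assumes L: "L > 0" and w: "\<And>i. smooth_on UNIV (w i)" "\<And>i. periodic L (w i)"
    and div: "\<And>x. (\<Sum>i\<in>UNIV. pderiv_at i (w i) x) = 0"
    and h: "smooth_on UNIV h" "periodic L h"
  shows "(\<Sum>k\<in>UNIV. cell_integral L (\<lambda>x. w k x * pderiv_at k h x * h x)) = 0"
proof -
  have "(\<Sum>k\<in>UNIV. cell_integral L (\<lambda>x. w k x * (pderiv_at k h x * h x + h x * pderiv_at k h x))) = 0"
    by (rule divergence_free_orthogonal_gradient[OF L w div
          torus_deriv_mult[OF torus_deriv_smooth[OF h] torus_deriv_smooth[OF h]]])
  moreover have "(\<lambda>x. w k x * (pderiv_at k h x * h x + h x * pderiv_at k h x))
      = (\<lambda>x. 2 * (w k x * pderiv_at k h x * h x))" for k by (auto simp: algebra_simps)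
  ultimately have "(\<Sum>k\<in>UNIV. 2 * cell_integral L (\<lambda>x. w k x * pderiv_at k h x * h x)) = 0"
    by simp
  then show ?thesis by (simp flip: sum_distrib_left)
qed

text \<open>Two integrations by parts, one in each direction. Summed over \<open>j\<close> and \<open>k\<close> it says that the \<open>L\<^sup>2\<close> norms of the
  Laplacian and of the Hessian agree, so that the viscous term of the enstrophy balance is exactly
  \<open>deriv_energy L 2\<close>.\<close>

lemma cell_integral_hessian:
  assumes L: "L > 0" and g: "smooth_on UNIV g" "periodic L g"
  shows "cell_integral L (\<lambda>x. pderiv_at j (pderiv_at j g) x * pderiv_at k (pderiv_at k g) x)
    = cell_integral L (\<lambda>x. (pderiv_at j (pderiv_at k g) x)\<^sup>2)"
proof -
  note sm = smooth_on_pderiv_at g periodic_pderiv_at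
  have c1: "pderiv_at k (pderiv_at j (pderiv_at j g)) = pderiv_at j (pderiv_at j (pderiv_at k g))"
    using pderiv_at_commute[OF smooth_on_pderiv_at[OF g(1)]] pderiv_at_commute[OF g(1)]
    by (metis ext)
  have "cell_integral L (\<lambda>x. pderiv_at j (pderiv_at j g) x * pderiv_at k (pderiv_at k g) x)
     = - cell_integral L (\<lambda>x. pderiv_at k (pderiv_at j (pderiv_at j g)) x * pderiv_at k g x)"
    by (intro integration_by_parts_torus[OF L torus_deriv_smooth torus_deriv_smooth] sm)
  also have "\<dots> = - cell_integral L (\<lambda>x. pderiv_at k g x * pderiv_at j (pderiv_at j (pderiv_at k g)) x)"
    by (simp add: c1 mult.commute)
  also have "\<dots> = cell_integral L (\<lambda>x. pderiv_at j (pderiv_at k g) x * pderiv_at j (pderiv_at k g) x)"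
    by (subst integration_by_parts_torus[OF L torus_deriv_smooth torus_deriv_smooth])
       (intro sm | simp)+
  finally show ?thesis by (simp add: power2_eq_square)
qed

section \<open>The first three derivative energies\<close>

lemma l2_norm_squared: "(l2_norm L g)\<^sup>2 = cell_integral L (\<lambda>x. (g x)\<^sup>2)"
proof -
  have "cell_integral L (\<lambda>x. (g x)\<^sup>2) \<ge> 0"
    by (cases "(\<lambda>x. (g x)\<^sup>2) integrable_on torus_cell L")
       (auto intro: integral_nonneg simp: not_integrable_integral)
  then show ?thesis by (simp add: l2_norm_def)
qed

lemma deriv_energy_nonneg: "deriv_energy L n v \<ge> 0"
  unfolding deriv_energy_def by (intro sum_nonneg) auto

lemma deriv_energy_0: "deriv_energy L 0 v = (\<Sum>i\<in>UNIV. cell_integral L (\<lambda>x. (v x $ i)\<^sup>2))"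
proof -
  have "{(n1, n2, n3). n1 + n2 + n3 = (0::nat)} = {(0, 0, 0)}" by auto
  then show ?thesis by (simp add: deriv_energy_def multi_deriv_def l2_norm_squared)
qed

lemma deriv_energy_1:
  "deriv_energy L 1 v
    = (\<Sum>i\<in>UNIV. \<Sum>j\<in>UNIV. cell_integral L (\<lambda>x. (pderiv_at j (\<lambda>x. v x $ i) x)\<^sup>2))"
proof -
  have *: "{(n1, n2, n3). n1 + n2 + n3 = (1::nat)} = {(1, 0, 0), (0, 1, 0), (0, 0, 1)}" by auto
  show ?thesis
    unfolding deriv_energy_def * multi_deriv_def
  proof (intro sum.cong refl)
    fix i :: 3
    show "(\<Sum>(n1, n2, n3)\<in>{(1, 0, 0), (0, 1, 0), (0, 0, 1)}.
          fact 1 / (fact n1 * fact n2 * fact n3) *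
          (l2_norm L ((\<lambda>(n1, n2, n3) g. (pderiv_at 1 ^^ n1) ((pderiv_at 2 ^^ n2) ((pderiv_at 3 ^^ n3) g)))
             (n1, n2, n3) (\<lambda>x. v x $ i)))\<^sup>2)
       = (\<Sum>j\<in>UNIV. cell_integral L (\<lambda>x. (pderiv_at j (\<lambda>x. v x $ i) x)\<^sup>2))"
      unfolding sum_3 l2_norm_squared by simp
  qed
qed

text \<open>The multinomial weight counts the orders in which a mixed derivative can be taken, so the sum over
  multi-indices equals the sum over all pairs of directions.\<close>

lemma deriv_energy_2:
  assumes "\<And>i. smooth_on UNIV (\<lambda>x. v x $ i)"
  shows "deriv_energy L 2 v = (\<Sum>i\<in>UNIV. \<Sum>j\<in>UNIV. \<Sum>k\<in>UNIV.
      cell_integral L (\<lambda>x. (pderiv_at j (pderiv_at k (\<lambda>x. v x $ i)) x)\<^sup>2))"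
proof -
  have "n1 + n2 + n3 = 2 \<longleftrightarrow>
      n1 = 2 \<and> n2 = 0 \<and> n3 = 0 \<or> n1 = 0 \<and> n2 = 2 \<and> n3 = 0 \<or> n1 = 0 \<and> n2 = 0 \<and> n3 = 2 \<or>
      n1 = 1 \<and> n2 = 1 \<and> n3 = 0 \<or> n1 = 1 \<and> n2 = 0 \<and> n3 = 1 \<or> n1 = 0 \<and> n2 = 1 \<and> n3 = 1"
    for n1 n2 n3 :: nat by presburger
  note eq = this
  have *: "{(n1, n2, n3). n1 + n2 + n3 = (2::nat)}
     = {(2, 0, 0), (0, 2, 0), (0, 0, 2), (1, 1, 0), (1, 0, 1), (0, 1, 1)}"
    unfolding eq by auto
  show ?thesis
    unfolding deriv_energy_def * multi_deriv_def
  proof (intro sum.cong refl)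
    fix i :: 3
    note c = pderiv_at_commute[OF assms]
    show "(\<Sum>(n1, n2, n3)\<in>{(2, 0, 0), (0, 2, 0), (0, 0, 2), (1, 1, 0), (1, 0, 1), (0, 1, 1)}.
          fact 2 / (fact n1 * fact n2 * fact n3) *
          (l2_norm L ((\<lambda>(n1, n2, n3) g. (pderiv_at 1 ^^ n1) ((pderiv_at 2 ^^ n2) ((pderiv_at 3 ^^ n3) g)))
             (n1, n2, n3) (\<lambda>x. v x $ i)))\<^sup>2)
       = (\<Sum>j\<in>UNIV. \<Sum>k\<in>UNIV. cell_integral L (\<lambda>x. (pderiv_at j (pderiv_at k (\<lambda>x. v x $ i)) x)\<^sup>2))"
      unfolding sum_3 l2_norm_squared c[of 2 1] c[of 3 1] c[of 3 2]
      by (simp add: numeral_2_eq_2)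
  qed
qed

section \<open>A pointwise bound by two derivatives\<close>

lemma content_torus_cell: "L > 0 \<Longrightarrow> measure lborel (torus_cell L) = L ^ 3"
  unfolding torus_cell_def
  by (subst content_cbox_cart) (auto simp: interval_ne_empty_cart)

lemma cell_integral_const: "L > 0 \<Longrightarrow> cell_integral L (\<lambda>x. c) = L ^ 3 * c"
  using content_torus_cell[of L] unfolding torus_cell_def by simp

text \<open>The Cauchy-Schwarz inequality against the constant \<open>1\<close>, obtained from the nonnegative variance of \<open>\<bar>g\<bar>\<close>.\<close>

lemma cell_integral_abs_le:
  assumes L: "L > 0" and g: "continuous_on UNIV g"
  shows "cell_integral L (\<lambda>x. \<bar>g x\<bar>) \<le> sqrt (L ^ 3 * cell_integral L (\<lambda>x. (g x)\<^sup>2))"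
proof -
  define A where "A = cell_integral L (\<lambda>x. \<bar>g x\<bar>)"
  define B where "B = cell_integral L (\<lambda>x. (g x)\<^sup>2)"
  define m where "m = A / L ^ 3"
  note int = continuous_integrable_on_cell
  have "0 \<le> cell_integral L (\<lambda>x. (\<bar>g x\<bar> - m)\<^sup>2)"
    by (intro integral_nonneg int continuous_intros g) auto
  also have "\<dots> = cell_integral L (\<lambda>x. (g x)\<^sup>2 - 2 * m * \<bar>g x\<bar> + m\<^sup>2)"
    by (intro integral_cong) (simp add: power2_diff)
  also have "\<dots> = B - 2 * m * A + L ^ 3 * m\<^sup>2"
  proof -
    have "(\<lambda>x. (g x)\<^sup>2) integrable_on torus_cell L" "(\<lambda>x. 2 * m * \<bar>g x\<bar>) integrable_on torus_cell L"
      "(\<lambda>x. m\<^sup>2) integrable_on torus_cell L"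
      by (intro int continuous_intros g)+
    then show ?thesis
      unfolding A_def B_def by (simp add: integral_add integral_diff integrable_diff cell_integral_const[OF L])
  qed
  also have "\<dots> = B - A\<^sup>2 / L ^ 3"
    using L by (simp add: m_def field_simps power2_eq_square)
  finally have "A\<^sup>2 \<le> L ^ 3 * B" using L by (simp add: field_simps)
  then show ?thesis unfolding A_def B_def by (rule real_le_rsqrt)
qed

lemma torus_cell_homothety:
  assumes "x0 \<in> torus_cell L" "0 \<le> s" "s \<le> 1" "z \<in> torus_cell L"
  shows "x0 + s *\<^sub>R (z - x0) \<in> torus_cell L"
proof -
  have "(1 - s) *\<^sub>R x0 + s *\<^sub>R z \<in> torus_cell L"
    using assms convex_box(1)[of 0 "(\<chi> i. L) :: real^3"] unfolding torus_cell_def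
    by (intro convexD) auto
  then show ?thesis by (simp add: algebra_simps)
qed

text \<open>The homothety with centre \<open>x0\<close> and ratio \<open>s\<close> maps the cell onto a smaller cube inside the cell and
  multiplies volumes by \<open>s ^ 3\<close>.\<close>

lemma cell_integral_homothety_le:
  assumes L: "L > 0" and x0: "x0 \<in> torus_cell L" and s: "0 < s" "s \<le> 1"
    and g: "continuous_on UNIV g" "\<And>x. g x \<ge> 0"
  shows "cell_integral L (\<lambda>z. g (x0 + s *\<^sub>R (z - x0))) \<le> cell_integral L g / s ^ 3"
proof -
  let ?c = "(\<chi> i. L) :: real^3" and ?d = "x0 - s *\<^sub>R x0"
  have ne: "cbox 0 ?c \<noteq> {}" using x0 by (auto simp: torus_cell_def)
  let ?Q = "cbox (s *\<^sub>R 0 + ?d) (s *\<^sub>R ?c + ?d)"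
  have Q: "?Q = (\<lambda>x. s *\<^sub>R x + ?d) ` cbox 0 ?c"
    using ne s by (simp add: image_affinity_cbox)
  have int: "g integrable_on cbox a b" for a b
    by (rule integrable_continuous) (rule continuous_on_subset[OF g(1)], simp)
  have "(\<lambda>x. (1 / s) *\<^sub>R x + - ((1 / s) *\<^sub>R ?d)) ` ?Q = cbox 0 ?c"
    unfolding Q image_image using s by (simp add: algebra_simps)
  then have "((\<lambda>x. g (s *\<^sub>R x + ?d)) has_integral (1 / s ^ 3) * integral ?Q g) (cbox 0 ?c)"
    using has_integral_affinity[OF integrable_integral[OF int, of "s *\<^sub>R 0 + ?d" "s *\<^sub>R ?c + ?d"], of s ?d] s
    by simp
  then have "cell_integral L (\<lambda>z. g (x0 + s *\<^sub>R (z - x0))) = integral ?Q g / s ^ 3"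
    unfolding torus_cell_def by (simp add: integral_unique algebra_simps)
  moreover have "integral ?Q g \<le> cell_integral L g"
  proof (rule integral_subset_le)
    show "?Q \<subseteq> torus_cell L"
    proof
      fix y assume "y \<in> ?Q"
      then obtain z where "z \<in> torus_cell L" "y = s *\<^sub>R z + ?d"
        unfolding Q torus_cell_def by auto
      moreover have "s *\<^sub>R z + ?d = x0 + s *\<^sub>R (z - x0)" by (simp add: algebra_simps)
      ultimately show "y \<in> torus_cell L"
        using torus_cell_homothety[OF x0 _ s(2)] s(1) by simp
    qed
  qed (use int g in \<open>auto simp: torus_cell_def\<close>)
  ultimately show ?thesis using s by (simp add: divide_right_mono)
qed

lemma sqrt_cube_powr:
  fixes x :: real
  assumes "x > 0"
  shows "sqrt (x ^ 3) = x powr (3/2)"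
proof -
  have "sqrt (x ^ 3) = (x powr 3) powr (1/2)"
    using assms powr_half_sqrt[of "x ^ 3"] by simp
  then show ?thesis by (simp add: powr_powr)
qed

lemma cell_integral_homothety_abs_le:
  assumes L: "L > 0" and x0: "x0 \<in> torus_cell L" and s: "0 < s" "s \<le> 1"
    and g: "continuous_on UNIV g"
  shows "cell_integral L (\<lambda>z. \<bar>g (x0 + s *\<^sub>R (z - x0))\<bar>)
    \<le> L powr (3/2) * s powr (-3/2) * sqrt (cell_integral L (\<lambda>x. (g x)\<^sup>2))"
proof -
  have c: "continuous_on UNIV (\<lambda>z. g (x0 + s *\<^sub>R (z - x0)))"
    by (intro continuous_on_compose2[OF g] continuous_intros) auto
  have "cell_integral L (\<lambda>z. \<bar>g (x0 + s *\<^sub>R (z - x0))\<bar>)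
      \<le> sqrt (L ^ 3 * cell_integral L (\<lambda>z. (g (x0 + s *\<^sub>R (z - x0)))\<^sup>2))"
    by (rule cell_integral_abs_le[OF L c])
  also have "\<dots> \<le> sqrt (L ^ 3 * (cell_integral L (\<lambda>x. (g x)\<^sup>2) / s ^ 3))"
    using L by (intro real_sqrt_le_mono mult_left_mono
        cell_integral_homothety_le[OF L x0 s, of "\<lambda>x. (g x)\<^sup>2"] continuous_intros g) auto
  also have "\<dots> = sqrt (L ^ 3) * (1 / sqrt (s ^ 3)) * sqrt (cell_integral L (\<lambda>x. (g x)\<^sup>2))"
    by (simp add: real_sqrt_mult real_sqrt_divide)
  also have "sqrt (L ^ 3) = L powr (3/2)" by (rule sqrt_cube_powr[OF L])
  also have "1 / sqrt (s ^ 3) = s powr (-3/2)"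
    using powr_minus_divide[of s "3/2"] by (simp add: sqrt_cube_powr[OF s(1)])
  finally show ?thesis .
qed

text \<open>The kernel \<open>min s (1 - s)\<close> is the Peano kernel of the second difference with nodes \<open>0\<close>, \<open>1/2\<close> and \<open>1\<close>. It is
  used to express \<open>h 0\<close> by two values away from \<open>0\<close> and by second derivatives, without first derivatives.\<close>

lemma midpoint_formula:
  fixes h h' h'' :: "real \<Rightarrow> real"
  assumes h: "\<And>s. (h has_field_derivative h' s) (at s)"
    and h': "\<And>s. (h' has_field_derivative h'' s) (at s)"
  shows "((\<lambda>s. min s (1 - s) * h'' s) has_integral (h 0 - 2 * h (1/2) + h 1)) {0..1}"
proof -
  have "((\<lambda>s. s * h'' s) has_integral ((1/2) * h' (1/2) - h (1/2) - (0 * h' 0 - h 0))) {0..1/2}"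
    by (rule fundamental_theorem_of_calculus)
       (auto simp: has_real_derivative_iff_has_vector_derivative[symmetric] 
             intro!: derivative_eq_intros has_field_derivative_at_within[OF h] has_field_derivative_at_within[OF h'])
  then have 1: "((\<lambda>s. min s (1 - s) * h'' s) has_integral ((1/2) * h' (1/2) - h (1/2) - (0 * h' 0 - h 0))) {0..1/2}"
    by (rule has_integral_eq[rotated]) auto
  have "((\<lambda>s. (1 - s) * h'' s) has_integral
      (((1 - 1) * h' 1 + h 1) - ((1 - 1/2) * h' (1/2) + h (1/2)))) {1/2..1}"
    by (rule fundamental_theorem_of_calculus)
       (auto simp: has_real_derivative_iff_has_vector_derivative[symmetric] 
             intro!: derivative_eq_intros has_field_derivative_at_within[OF h] has_field_derivative_at_within[OF h'])
  then have 2: "((\<lambda>s. min s (1 - s) * h'' s) has_integral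
      (((1 - 1) * h' 1 + h 1) - ((1 - 1/2) * h' (1/2) + h (1/2)))) {1/2..1}"
    by (rule has_integral_eq[rotated]) auto
  show ?thesis using has_integral_combine[OF _ _ 1 2] by (simp add: algebra_simps)
qed

lemma smooth_on_line_derivative:
  assumes "smooth_on UNIV g"
  shows "((\<lambda>s. g (x + s *\<^sub>R v)) has_field_derivative
    (\<Sum>j\<in>UNIV. v $ j * pderiv_at j g (x + s *\<^sub>R v))) (at s)"
proof -
  let ?D = "\<lambda>w. \<Sum>j\<in>UNIV. w $ j * pderiv_at j g (x + s *\<^sub>R v)"
  have "((\<lambda>s. x + s *\<^sub>R v) has_derivative (\<lambda>d. d *\<^sub>R v)) (at s)"
    by (auto intro!: derivative_eq_intros)
  from diff_chain_at[OF this has_derivative_sum_pderiv_at[OF assms, of "x + s *\<^sub>R v"]]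
  have "((\<lambda>s. g (x + s *\<^sub>R v)) has_derivative (\<lambda>d. ?D (d *\<^sub>R v))) (at s)"
    by (simp add: o_def)
  moreover have "(\<lambda>d. ?D (d *\<^sub>R v)) = (*) (?D v)"
    by (auto simp: fun_eq_iff sum_distrib_left sum_distrib_right mult_ac)
  ultimately show ?thesis by (simp add: has_field_derivative_def)
qed

text \<open>For \<open>z\<close> in the cell, apply the midpoint formula on the segment from \<open>x0\<close> to \<open>x0 + r *\<^sub>R (z - x0)\<close> and average
  over \<open>z\<close>. The segment stays in the cell by convexity. The two values away from \<open>x0\<close> average to
  at most a multiple of \<open>r powr (-3/2)\<close> times the \<open>L\<^sup>2\<close> norm of \<open>g\<close>. At the parameter \<open>s\<close>, the second derivatives average
  to at most a multiple of \<open>r\<^sup>2 * (s * r) powr (-3/2)\<close> times their \<open>L\<^sup>2\<close> norm. The kernel is at most \<open>s\<close>, which leaves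
  the integrable singularity \<open>s powr (-1/2)\<close>; this is where it matters that the dimension is below \<open>4\<close>.
  Choosing \<open>r\<close> optimally turns the bound into Agmon's inequality.\<close>

lemma pointwise_bound_torus:
  assumes L: "L > 0" and x0: "x0 \<in> torus_cell L" and r: "0 < r" "r \<le> 1"
    and g: "smooth_on UNIV g"
  shows "\<bar>g x0\<bar> \<le> 7 * L powr (-3/2) * r powr (-3/2) * sqrt (cell_integral L (\<lambda>x. (g x)\<^sup>2))
    + 18 * L powr (1/2) * r powr (1/2) *
      sqrt (\<Sum>j\<in>UNIV. \<Sum>k\<in>UNIV. cell_integral L (\<lambda>x. (pderiv_at j (pderiv_at k g) x)\<^sup>2))"
proof -
  let ?c = "(\<chi> i. L) :: real^3"
  define H where "H = (\<lambda>j k. pderiv_at j (pderiv_at k g))"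
  define N where "N = sqrt (cell_integral L (\<lambda>x. (g x)\<^sup>2))"
  define D where "D = sqrt (\<Sum>j\<in>UNIV. \<Sum>k\<in>UNIV. cell_integral L (\<lambda>x. (H j k x)\<^sup>2))"
  have smH: "smooth_on UNIV (H j k)" for j k unfolding H_def by (intro smooth_on_pderiv_at g)
  note contH = smooth_on_imp_continuous_on[OF smH] and contg = smooth_on_imp_continuous_on[OF g]
  note int = continuous_integrable_on_cell
  define P where "P = (\<lambda>\<rho> z. x0 + \<rho> *\<^sub>R (z - x0))"
  define Q where "Q = (\<lambda>s z. \<Sum>j\<in>UNIV. \<Sum>k\<in>UNIV. (z - x0) $ j * (z - x0) $ k * H j k (P (s * r) z))"
  have contP: "continuous_on A (\<lambda>z. P (f1 z) (f2 z))"
    if "continuous_on A f1" "continuous_on A f2" for A :: "'a::topological_space set" and f1 f2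
    unfolding P_def by (intro continuous_intros that)
  have contgP: "continuous_on UNIV (\<lambda>z. g (P \<rho> z))" for \<rho>
    by (intro continuous_on_compose2[OF contg] contP continuous_intros) auto
  have contQ: "continuous_on A (\<lambda>z. Q (f1 z) (f2 z))"
    if "continuous_on A f1" "continuous_on A f2" for A :: "'a::topological_space set" and f1 f2
    unfolding Q_def
    by (intro continuous_intros continuous_on_compose2[OF contH] contP that) auto
  have taylor: "((\<lambda>s. r\<^sup>2 * (min s (1 - s) * Q s z)) has_integral
      (g x0 - 2 * g (P (r/2) z) + g (P r z))) {0..1}" for z
  proof -
    let ?v = "r *\<^sub>R (z - x0)"
    have "((\<lambda>s. min s (1 - s) * (\<Sum>k\<in>UNIV. ?v $ k * (\<Sum>j\<in>UNIV. ?v $ j * H j k (x0 + s *\<^sub>R ?v))))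
      has_integral (g (x0 + 0 *\<^sub>R ?v) - 2 * g (x0 + (1/2) *\<^sub>R ?v) + g (x0 + 1 *\<^sub>R ?v))) {0..1}"
      unfolding H_def
      by (intro midpoint_formula[where h'="\<lambda>s. \<Sum>k\<in>UNIV. ?v $ k * pderiv_at k g (x0 + s *\<^sub>R ?v)"]
            smooth_on_line_derivative g DERIV_sum DERIV_cmult smooth_on_pderiv_at)
    moreover have "(\<Sum>k\<in>UNIV. ?v $ k * (\<Sum>j\<in>UNIV. ?v $ j * H j k (x0 + s *\<^sub>R ?v))) = r\<^sup>2 * Q s z" for s
      unfolding Q_def P_def
      by (subst sum.swap) (simp add: sum_distrib_left power2_eq_square mult_ac)
    ultimately show ?thesis by (simp add: P_def mult_ac)
  qed
  have Qbound: "cell_integral L (\<lambda>z. \<bar>Q s z\<bar>) \<le> 9 * L\<^sup>2 * (L powr (3/2) * (s * r) powr (-3/2) * D)"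
    if s: "0 < s" "s \<le> 1" for s
  proof -
    have "cell_integral L (\<lambda>z. \<bar>Q s z\<bar>)
        \<le> cell_integral L (\<lambda>z. \<Sum>j\<in>UNIV. \<Sum>k\<in>UNIV. L\<^sup>2 * \<bar>H j k (P (s * r) z)\<bar>)"
    proof (rule integral_le)
      fix z assume z: "z \<in> torus_cell L"
      have "\<bar>(z - x0) $ i\<bar> \<le> L" for i
        using z x0 unfolding torus_cell_def mem_box_cart
        by (auto simp: abs_le_iff dest!: spec[of _ i])
      then have *: "\<bar>(z - x0) $ j\<bar> * \<bar>(z - x0) $ k\<bar> \<le> L\<^sup>2" for j k
        unfolding power2_eq_square using L by (intro mult_mono) auto
      have "\<bar>Q s z\<bar> \<le> (\<Sum>j\<in>UNIV. \<Sum>k\<in>UNIV. \<bar>(z - x0) $ j * (z - x0) $ k * H j k (P (s * r) z)\<bar>)"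
        unfolding Q_def by (intro order.trans[OF sum_abs] sum_mono) auto
      also have "\<dots> \<le> (\<Sum>j\<in>UNIV. \<Sum>k\<in>UNIV. L\<^sup>2 * \<bar>H j k (P (s * r) z)\<bar>)"
        unfolding abs_mult by (intro sum_mono mult_right_mono *) auto
      finally show "\<bar>Q s z\<bar> \<le> (\<Sum>j\<in>UNIV. \<Sum>k\<in>UNIV. L\<^sup>2 * \<bar>H j k (P (s * r) z)\<bar>)" .
    qed (intro int continuous_intros contQ continuous_on_compose2[OF contH] contP; simp)+
    also have "\<dots> = (\<Sum>j\<in>UNIV. \<Sum>k\<in>UNIV. L\<^sup>2 * cell_integral L (\<lambda>z. \<bar>H j k (P (s * r) z)\<bar>))"
      by (subst cell_integral_sum, (intro continuous_intros continuous_on_compose2[OF contH] contP; simp))+ simp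
    also have "\<dots> \<le> (\<Sum>j\<in>(UNIV::3 set). \<Sum>k\<in>(UNIV::3 set). L\<^sup>2 * (L powr (3/2) * (s * r) powr (-3/2) * D))"
    proof (intro sum_mono mult_left_mono)
      fix j k :: 3
      have nn: "cell_integral L (\<lambda>x. (H j k x)\<^sup>2) \<ge> 0" for j k
        by (intro integral_nonneg int continuous_intros contH) auto
      have "cell_integral L (\<lambda>x. (H j k x)\<^sup>2) \<le> (\<Sum>k\<in>UNIV. cell_integral L (\<lambda>x. (H j k x)\<^sup>2))"
        by (rule member_le_sum) (use nn in auto)
      also have "\<dots> \<le> (\<Sum>j\<in>UNIV. \<Sum>k\<in>UNIV. cell_integral L (\<lambda>x. (H j k x)\<^sup>2))"
        by (rule member_le_sum[of j UNIV "\<lambda>j. \<Sum>k\<in>UNIV. cell_integral L (\<lambda>x. (H j k x)\<^sup>2)"])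
           (use nn in \<open>auto intro: sum_nonneg\<close>)
      finally have "sqrt (cell_integral L (\<lambda>x. (H j k x)\<^sup>2)) \<le> D" unfolding D_def by simp
      moreover have "cell_integral L (\<lambda>z. \<bar>H j k (P (s * r) z)\<bar>)
          \<le> L powr (3/2) * (s * r) powr (-3/2) * sqrt (cell_integral L (\<lambda>x. (H j k x)\<^sup>2))"
        unfolding P_def using s r
        by (intro cell_integral_homothety_abs_le L x0 contH) (auto intro: mult_le_one)
      ultimately show "cell_integral L (\<lambda>z. \<bar>H j k (P (s * r) z)\<bar>)
          \<le> L powr (3/2) * (s * r) powr (-3/2) * D"
        by (meson mult_left_mono order.trans mult_nonneg_nonneg powr_ge_zero)
    qed auto
    also have "\<dots> = 9 * L\<^sup>2 * (L powr (3/2) * (s * r) powr (-3/2) * D)" by simp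
    finally show ?thesis .
  qed
  define R where "R = cell_integral L (\<lambda>z. g x0 - 2 * g (P (r/2) z) + g (P r z))"
  have "R = cell_integral L (\<lambda>z. integral (cbox 0 1) (\<lambda>s. r\<^sup>2 * (min s (1 - s) * Q s z)))"
    unfolding R_def box_real(2) integral_unique[OF taylor] ..
  also have "\<dots> = integral (cbox 0 1) (\<lambda>s. cell_integral L (\<lambda>z. r\<^sup>2 * (min s (1 - s) * Q s z)))"
    unfolding torus_cell_def
    by (rule integral_swap_continuous)
       (auto simp: case_prod_unfold intro!: continuous_intros contQ)
  finally have Req: "R = integral {0..1} (\<lambda>s. cell_integral L (\<lambda>z. r\<^sup>2 * (min s (1 - s) * Q s z)))"
    by simp
  \<comment> \<open>nine second derivatives, each weighted by at most \<open>L\<^sup>2\<close>\<close>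
  define C where "C = 9 * L powr (7/2) * r powr (1/2) * D"
  have pw: "((\<lambda>s. C * s powr (-1/2)) has_integral C * 2) {0..1}"
    using has_integral_mult_right[OF has_integral_powr_from_0[of "-1/2" 1], of C] by simp
  have "\<bar>R\<bar> \<le> integral {0..1} (\<lambda>s. C * s powr (-1/2))"
    unfolding Req real_norm_def[symmetric]
  proof (rule integral_norm_bound_integral)
    show "(\<lambda>s. cell_integral L (\<lambda>z. r\<^sup>2 * (min s (1 - s) * Q s z))) integrable_on {0..1}"
      unfolding torus_cell_def
      by (intro integrable_continuous_real integral_continuous_on_param)
         (auto simp: case_prod_unfold intro!: continuous_intros contQ)
    show "(\<lambda>s. C * s powr (-1/2)) integrable_on {0..1}"
      using pw by (rule has_integral_integrable)
    fix s :: real assume s: "s \<in> {0..1}"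
    show "norm (cell_integral L (\<lambda>z. r\<^sup>2 * (min s (1 - s) * Q s z))) \<le> C * s powr (-1/2)"
    \<comment> \<open>at \<open>s = 0\<close> the kernel vanishes, and so does the bound because \<open>0 powr (-1/2) = 0\<close>\<close>
    proof (cases "s = 0")
      case False
      then have s: "0 < s" "s \<le> 1" using s by auto
      have "\<bar>cell_integral L (Q s)\<bar> \<le> cell_integral L (\<lambda>z. \<bar>Q s z\<bar>)"
        unfolding real_norm_def[symmetric]
        by (rule integral_norm_bound_integral) (intro int continuous_intros contQ | simp)+
      also note Qbound[OF s]
      finally have "\<bar>r\<^sup>2 * (min s (1 - s) * cell_integral L (Q s))\<bar>
          \<le> r\<^sup>2 * (s * (9 * L\<^sup>2 * (L powr (3/2) * (s * r) powr (-3/2) * D)))"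
        unfolding abs_mult using s by (intro mult_mono) auto
      also have "\<dots> = 9 * (L powr 2 * L powr (3/2)) * (r powr 2 * r powr (-3/2)) * D * (s powr 1 * s powr (-3/2))"
        using s r L by (simp add: powr_mult)
      also have "\<dots> = C * s powr (-1/2)"
        unfolding C_def powr_add[symmetric] by simp
      finally show ?thesis by simp
    qed simp
  qed
  also have "\<dots> = 2 * C"
    using integral_unique[OF pw] by simp
  finally have R: "\<bar>R\<bar> \<le> 2 * C" .
  have Rsplit: "R = L ^ 3 * g x0 - 2 * cell_integral L (\<lambda>z. g (P (r/2) z)) + cell_integral L (\<lambda>z. g (P r z))"
  proof -
    have "(\<lambda>z. g x0) integrable_on torus_cell L" "(\<lambda>z. 2 * g (P (r/2) z)) integrable_on torus_cell L"
      "(\<lambda>z. g (P r z)) integrable_on torus_cell L"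
      by (intro int continuous_intros contgP)+
    then show ?thesis
      unfolding R_def by (simp add: integral_add integral_diff integrable_diff cell_integral_const[OF L])
  qed
  have mean: "\<bar>cell_integral L (\<lambda>z. g (P \<rho> z))\<bar> \<le> L powr (3/2) * \<rho> powr (-3/2) * N"
    if "0 < \<rho>" "\<rho> \<le> 1" for \<rho>
  proof -
    have "\<bar>cell_integral L (\<lambda>z. g (P \<rho> z))\<bar> \<le> cell_integral L (\<lambda>z. \<bar>g (P \<rho> z)\<bar>)"
      unfolding real_norm_def[symmetric]
      by (rule integral_norm_bound_integral) (intro int continuous_intros contgP | simp)+
    also have "\<dots> \<le> L powr (3/2) * \<rho> powr (-3/2) * N"
      unfolding P_def N_def by (rule cell_integral_homothety_abs_le[OF L x0 that contg])
    finally show ?thesis .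
  qed
  have half: "(r/2) powr (-3/2) \<le> 3 * r powr (-3/2)"
  proof -
    have "(2::real) powr (3/2) = sqrt (2 ^ 3)"
      by (rule sqrt_cube_powr[symmetric]) simp
    also have "\<dots> \<le> 3" by (rule real_le_lsqrt) auto
    finally have "(2::real) powr (3/2) \<le> 3" .
    moreover have "(r/2) powr (-3/2) = 2 powr (3/2) * r powr (-3/2)"
      using r powr_minus_divide[of "2::real" "3/2"] by (simp add: powr_divide)
    ultimately show ?thesis by (simp add: mult_right_mono)
  qed
  have "0 \<le> N" by (auto simp: N_def intro!: integral_nonneg int continuous_intros contg)
  then have "L powr (3/2) * (r/2) powr (-3/2) * N \<le> L powr (3/2) * (3 * r powr (-3/2)) * N"
    by (intro mult_right_mono mult_left_mono half) auto
  then have "L ^ 3 * \<bar>g x0\<bar> \<le> 2 * C + 7 * (L powr (3/2) * r powr (-3/2) * N)"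
    using mean[of r] mean[of "r/2"] r R Rsplit L abs_mult[of "L ^ 3" "g x0"] by (simp add: algebra_simps) 
  also have "\<dots> = L ^ 3 * (7 * L powr (-3/2) * r powr (-3/2) * N + 18 * L powr (1/2) * r powr (1/2) * D)"
  proof -
    have *: "L powr (3/2) = L ^ 3 * L powr (-3/2)" "L powr (7/2) = L ^ 3 * L powr (1/2)"
      using L powr_add[of L 3 "-3/2"] powr_add[of L 3 "1/2"] by simp_all
    show ?thesis unfolding C_def * by (simp add: algebra_simps)
  qed
  finally show ?thesis using L unfolding N_def D_def H_def by simp
qed

section \<open>Energy and enstrophy balance\<close>

lemma cell_integral_linear4:
  assumes "continuous_on UNIV a" "continuous_on UNIV b" "continuous_on UNIV c" "continuous_on UNIV d"
  shows "cell_integral L (\<lambda>x. \<nu> * a x - b x + c x - d x)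
    = \<nu> * cell_integral L a - cell_integral L b + cell_integral L c - cell_integral L d"
proof -
  have "a integrable_on torus_cell L" "b integrable_on torus_cell L"
    "c integrable_on torus_cell L" "d integrable_on torus_cell L"
    "(\<lambda>x. \<nu> * a x) integrable_on torus_cell L"
    by (intro continuous_integrable_on_cell continuous_intros assms)+
  then show ?thesis by (simp add: integral_add integral_diff integrable_diff integrable_add)
qed

lemma momentum_tested:
  fixes w V F :: "3 \<Rightarrow> real^3 \<Rightarrow> real"
  assumes w: "\<And>i. smooth_on UNIV (w i)" and F: "smooth_on UNIV (F i)"
    and p: "smooth_on UNIV p" and h: "smooth_on UNIV h"
    and eq: "\<And>x. V i x + (\<Sum>k\<in>UNIV. w k x * pderiv_at k (w i) x)
      = \<nu> * (\<Sum>k\<in>UNIV. pderiv_at k (pderiv_at k (w i)) x) - pderiv_at i p x + F i x"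
  shows "cell_integral L (\<lambda>x. h x * V i x)
     = \<nu> * (\<Sum>k\<in>UNIV. cell_integral L (\<lambda>x. h x * pderiv_at k (pderiv_at k (w i)) x))
       - cell_integral L (\<lambda>x. h x * pderiv_at i p x) + cell_integral L (\<lambda>x. h x * F i x)
       - (\<Sum>k\<in>UNIV. cell_integral L (\<lambda>x. h x * (w k x * pderiv_at k (w i) x)))"
proof -
  note c = continuous_intros smooth_on_imp_continuous_on smooth_on_pderiv_at w F p h
  have "h x * V i x = \<nu> * (\<Sum>k\<in>UNIV. h x * pderiv_at k (pderiv_at k (w i)) x)
       - h x * pderiv_at i p x + h x * F i x - (\<Sum>k\<in>UNIV. h x * (w k x * pderiv_at k (w i) x))" for x
  proof -
    have "V i x = \<nu> * (\<Sum>k\<in>UNIV. pderiv_at k (pderiv_at k (w i)) x) - pderiv_at i p x + F i x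
      - (\<Sum>k\<in>UNIV. w k x * pderiv_at k (w i) x)" using eq[of x] by simp
    then show ?thesis
      unfolding sum_distrib_left[symmetric] by (simp only: ring_distribs mult.left_commute)
  qed
  then have "cell_integral L (\<lambda>x. h x * V i x)
     = cell_integral L (\<lambda>x. \<nu> * (\<Sum>k\<in>UNIV. h x * pderiv_at k (pderiv_at k (w i)) x)
       - h x * pderiv_at i p x + h x * F i x - (\<Sum>k\<in>UNIV. h x * (w k x * pderiv_at k (w i) x)))"
    by simp
  also have "\<dots> = \<nu> * cell_integral L (\<lambda>x. \<Sum>k\<in>UNIV. h x * pderiv_at k (pderiv_at k (w i)) x)
       - cell_integral L (\<lambda>x. h x * pderiv_at i p x) + cell_integral L (\<lambda>x. h x * F i x)
       - cell_integral L (\<lambda>x. \<Sum>k\<in>UNIV. h x * (w k x * pderiv_at k (w i) x))"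
    by (intro cell_integral_linear4 c)
  also have "cell_integral L (\<lambda>x. \<Sum>k\<in>UNIV. h x * pderiv_at k (pderiv_at k (w i)) x)
     = (\<Sum>k\<in>UNIV. cell_integral L (\<lambda>x. h x * pderiv_at k (pderiv_at k (w i)) x))"
    by (intro cell_integral_sum c)
  also have "cell_integral L (\<lambda>x. \<Sum>k\<in>UNIV. h x * (w k x * pderiv_at k (w i) x))
     = (\<Sum>k\<in>UNIV. cell_integral L (\<lambda>x. h x * (w k x * pderiv_at k (w i) x)))"
    by (intro cell_integral_sum c)
  finally show ?thesis .
qed

text \<open>The Navier-Stokes equations at one instant, with \<open>V\<close> in the role of the time derivative of \<open>w\<close>.\<close>

locale momentum_balance =
  fixes L \<nu> :: real and w V F :: "3 \<Rightarrow> real^3 \<Rightarrow> real" and p :: "real^3 \<Rightarrow> real"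
  assumes L: "L > 0" and \<nu>: "\<nu> > 0"
    and w: "\<And>i. smooth_on UNIV (w i)" "\<And>i. periodic L (w i)"
    and V: "\<And>i. smooth_on UNIV (V i)" "\<And>i. periodic L (V i)"
    and F: "\<And>i. smooth_on UNIV (F i)" "\<And>i. periodic L (F i)"
    and p: "smooth_on UNIV p" "periodic L p"
    and eq: "\<And>i x. V i x + (\<Sum>k\<in>UNIV. w k x * pderiv_at k (w i) x)
      = \<nu> * (\<Sum>k\<in>UNIV. pderiv_at k (pderiv_at k (w i)) x) - pderiv_at i p x + F i x"
    and div: "\<And>x. (\<Sum>i\<in>UNIV. pderiv_at i (w i) x) = 0"
begin

text \<open>Test the momentum equation with \<open>w\<close>: transport and pressure do no work.\<close>

lemma energy_balance:
  "(\<Sum>i\<in>UNIV. cell_integral L (\<lambda>x. w i x * V i x))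
    = - \<nu> * (\<Sum>i\<in>UNIV. \<Sum>j\<in>UNIV. cell_integral L (\<lambda>x. (pderiv_at j (w i) x)\<^sup>2))
      + (\<Sum>i\<in>UNIV. cell_integral L (\<lambda>x. w i x * F i x))"
proof -
  have "cell_integral L (\<lambda>x. w i x * V i x)
     = - \<nu> * (\<Sum>j\<in>UNIV. cell_integral L (\<lambda>x. (pderiv_at j (w i) x)\<^sup>2))
       - cell_integral L (\<lambda>x. w i x * pderiv_at i p x) + cell_integral L (\<lambda>x. w i x * F i x)" for i
  proof -
    have 1: "cell_integral L (\<lambda>x. w i x * pderiv_at k (pderiv_at k (w i)) x)
        = - cell_integral L (\<lambda>x. (pderiv_at k (w i) x)\<^sup>2)" for k
      unfolding power2_eq_square
      by (intro integration_by_parts_torus[OF L torus_deriv_smooth torus_deriv_smooth]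
          smooth_on_pderiv_at periodic_pderiv_at w)
    have 2: "(\<Sum>k\<in>UNIV. cell_integral L (\<lambda>x. w i x * (w k x * pderiv_at k (w i) x))) = 0"
      using transport_cancels[OF L w div w, of i] by (simp add: mult_ac)
    have "cell_integral L (\<lambda>x. w i x * V i x)
      = \<nu> * (\<Sum>k\<in>UNIV. cell_integral L (\<lambda>x. w i x * pderiv_at k (pderiv_at k (w i)) x))
       - cell_integral L (\<lambda>x. w i x * pderiv_at i p x) + cell_integral L (\<lambda>x. w i x * F i x)
       - (\<Sum>k\<in>UNIV. cell_integral L (\<lambda>x. w i x * (w k x * pderiv_at k (w i) x)))"
      by (intro momentum_tested eq w F p)
    then show ?thesis unfolding 1 2 by (simp add: sum_negf)
  qed
  then show ?thesis
    using divergence_free_orthogonal_gradient[OF L w div torus_deriv_smooth[OF p]]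
    by (simp add: sum.distrib sum_subtractf sum_negf sum_distrib_left[symmetric])
qed

text \<open>Test the momentum equation with the Laplacian of \<open>w\<close>. The pressure drops out because second derivatives
  of \<open>w\<close> are again divergence-free. Integrating the nonlinear term by parts in the direction \<open>j\<close> moves one
  derivative onto \<open>w k * pderiv_at k (w i)\<close>. If it falls on the second factor, the result is transport of
  \<open>pderiv_at j (w i)\<close> and cancels; what remains is the stretching term, cubic in the gradient.\<close>

lemma enstrophy_balance:
  "(\<Sum>i\<in>UNIV. \<Sum>j\<in>UNIV. cell_integral L (\<lambda>x. pderiv_at j (w i) x * pderiv_at j (V i) x))
    = - \<nu> * (\<Sum>i\<in>UNIV. \<Sum>j\<in>UNIV. \<Sum>k\<in>UNIV. cell_integral L (\<lambda>x. (pderiv_at j (pderiv_at k (w i)) x)\<^sup>2))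
      - (\<Sum>i\<in>UNIV. \<Sum>j\<in>UNIV. \<Sum>k\<in>UNIV.
          cell_integral L (\<lambda>x. pderiv_at j (w k) x * (pderiv_at j (w i) x * pderiv_at k (w i) x)))
      + (\<Sum>i\<in>UNIV. \<Sum>j\<in>UNIV. cell_integral L (\<lambda>x. pderiv_at j (w i) x * pderiv_at j (F i) x))"
proof -
  define PP where "PP = (\<lambda>i j. cell_integral L (\<lambda>x. pderiv_at j (pderiv_at j (w i)) x * pderiv_at i p x))"
  note sm = smooth_on_pderiv_at periodic_pderiv_at w F V p
  note ibp = integration_by_parts_torus[OF L torus_deriv_smooth torus_deriv_smooth]
  have "cell_integral L (\<lambda>x. pderiv_at j (w i) x * pderiv_at j (V i) x)
     = - \<nu> * (\<Sum>k\<in>UNIV. cell_integral L (\<lambda>x. (pderiv_at j (pderiv_at k (w i)) x)\<^sup>2))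
       - (\<Sum>k\<in>UNIV. cell_integral L (\<lambda>x. pderiv_at j (w k) x * (pderiv_at j (w i) x * pderiv_at k (w i) x)))
       + cell_integral L (\<lambda>x. pderiv_at j (w i) x * pderiv_at j (F i) x) + PP i j" for i j
  proof -
    let ?h = "pderiv_at j (pderiv_at j (w i))"
    have 1: "cell_integral L (\<lambda>x. pderiv_at j (w i) x * pderiv_at j (V i) x)
        = - cell_integral L (\<lambda>x. ?h x * V i x)"
      by (intro ibp sm)
    have 2: "cell_integral L (\<lambda>x. pderiv_at j (w i) x * pderiv_at j (F i) x)
        = - cell_integral L (\<lambda>x. ?h x * F i x)"
      by (intro ibp sm)
    have 3: "cell_integral L (\<lambda>x. ?h x * pderiv_at k (pderiv_at k (w i)) x)
        = cell_integral L (\<lambda>x. (pderiv_at j (pderiv_at k (w i)) x)\<^sup>2)" for k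
      by (rule cell_integral_hessian[OF L w])
    have 4: "cell_integral L (\<lambda>x. ?h x * (w k x * pderiv_at k (w i) x))
        = - cell_integral L (\<lambda>x. pderiv_at j (w k) x * (pderiv_at j (w i) x * pderiv_at k (w i) x))
          - cell_integral L (\<lambda>x. w k x * pderiv_at k (pderiv_at j (w i)) x * pderiv_at j (w i) x)" for k
    proof -
      have "cell_integral L (\<lambda>x. (w k x * pderiv_at k (w i) x) * ?h x)
         = - cell_integral L (\<lambda>x. (pderiv_at j (w k) x * pderiv_at k (w i) x
            + w k x * pderiv_at j (pderiv_at k (w i)) x) * pderiv_at j (w i) x)"
        by (intro integration_by_parts_torus[OF L torus_deriv_mult[OF torus_deriv_smooth torus_deriv_smooth]
              torus_deriv_smooth] sm)
      also have "\<dots> = - cell_integral L (\<lambda>x. pderiv_at j (w k) x * (pderiv_at j (w i) x * pderiv_at k (w i) x)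
            + w k x * pderiv_at k (pderiv_at j (w i)) x * pderiv_at j (w i) x)"
        by (simp add: pderiv_at_commute[OF w(1), of j k] algebra_simps)
      also have "\<dots> = - (cell_integral L (\<lambda>x. pderiv_at j (w k) x * (pderiv_at j (w i) x * pderiv_at k (w i) x))
          + cell_integral L (\<lambda>x. w k x * pderiv_at k (pderiv_at j (w i)) x * pderiv_at j (w i) x))"
        by (subst integral_add)
           (intro continuous_integrable_on_cell continuous_intros smooth_on_imp_continuous_on sm refl)+
      finally show ?thesis by (simp add: mult_ac)
    qed
    have 5: "(\<Sum>k\<in>UNIV. cell_integral L (\<lambda>x. w k x * pderiv_at k (pderiv_at j (w i)) x * pderiv_at j (w i) x)) = 0"
      by (intro transport_cancels L sm div)
    have "cell_integral L (\<lambda>x. ?h x * V i x)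
      = \<nu> * (\<Sum>k\<in>UNIV. cell_integral L (\<lambda>x. ?h x * pderiv_at k (pderiv_at k (w i)) x))
       - cell_integral L (\<lambda>x. ?h x * pderiv_at i p x) + cell_integral L (\<lambda>x. ?h x * F i x)
       - (\<Sum>k\<in>UNIV. cell_integral L (\<lambda>x. ?h x * (w k x * pderiv_at k (w i) x)))"
      by (intro momentum_tested eq sm)
    then show ?thesis
      unfolding 1 2 3 4 sum_subtractf sum_negf 5 by (simp add: PP_def)
  qed
  moreover have "(\<Sum>i\<in>UNIV. PP i j) = 0" for j
    unfolding PP_def
    by (intro divergence_free_orthogonal_gradient[where q=p] L torus_deriv_smooth sm
        divergence_free_pderiv_at div)
  then have "(\<Sum>i\<in>UNIV. \<Sum>j\<in>UNIV. PP i j) = 0" by (subst sum.swap) simp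
  ultimately show ?thesis
    by (simp add: sum.distrib sum_subtractf sum_negf sum_distrib_left[symmetric])
qed

text \<open>Bound the factor \<open>pderiv_at j (w k) x\<close> by \<open>G\<close> and the product of the other two by the mean of their squares.
  Each square then has the total weight \<open>3 * G\<close>; this \<open>3\<close> is the constant \<open>c1\<close> of the theorem.\<close>

lemma vortex_stretching_bound:
  assumes G: "\<And>i j x. x \<in> torus_cell L \<Longrightarrow> \<bar>pderiv_at j (w i) x\<bar> \<le> G"
  shows "- (\<Sum>i\<in>UNIV. \<Sum>j\<in>UNIV. \<Sum>k\<in>UNIV.
          cell_integral L (\<lambda>x. pderiv_at j (w k) x * (pderiv_at j (w i) x * pderiv_at k (w i) x)))
    \<le> 3 * G * (\<Sum>i\<in>UNIV. \<Sum>j\<in>UNIV. cell_integral L (\<lambda>x. (pderiv_at j (w i) x)\<^sup>2))"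
proof -
  define A where "A = (\<lambda>i j. cell_integral L (\<lambda>x. (pderiv_at j (w i) x)\<^sup>2))"
  note c = continuous_integrable_on_cell continuous_intros smooth_on_imp_continuous_on smooth_on_pderiv_at w
  have "- cell_integral L (\<lambda>x. pderiv_at j (w k) x * (pderiv_at j (w i) x * pderiv_at k (w i) x))
      \<le> G / 2 * (A i j + A i k)" for i j k
  proof -
    have "- cell_integral L (\<lambda>x. pderiv_at j (w k) x * (pderiv_at j (w i) x * pderiv_at k (w i) x))
       = cell_integral L (\<lambda>x. - (pderiv_at j (w k) x * (pderiv_at j (w i) x * pderiv_at k (w i) x)))"
      by simp
    also have "\<dots> \<le> cell_integral L (\<lambda>x. G / 2 * ((pderiv_at j (w i) x)\<^sup>2 + (pderiv_at k (w i) x)\<^sup>2))"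
    proof (rule integral_le)
      fix x assume "x \<in> torus_cell L"
      note g = G[OF this, of j k]
      let ?a = "pderiv_at j (w i) x" and ?b = "pderiv_at k (w i) x" and ?d = "pderiv_at j (w k) x"
      have "- (?d * (?a * ?b)) \<le> \<bar>?d\<bar> * \<bar>?a * ?b\<bar>" by (metis abs_ge_minus_self abs_mult)
      also have "\<dots> \<le> G * ((?a\<^sup>2 + ?b\<^sup>2) / 2)"
      proof (intro mult_mono g)
        have "0 \<le> (\<bar>?a\<bar> - \<bar>?b\<bar>)\<^sup>2" by simp
        then show "\<bar>?a * ?b\<bar> \<le> (?a\<^sup>2 + ?b\<^sup>2) / 2"
          by (simp add: power2_diff abs_mult)
      qed (use g in auto)
      finally show "- (?d * (?a * ?b)) \<le> G / 2 * (?a\<^sup>2 + ?b\<^sup>2)" by simp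
    qed (intro c)+
    also have "\<dots> = G / 2 * (A i j + A i k)"
      unfolding A_def integral_mult_right
      by (subst integral_add) (intro c refl)+
    finally show ?thesis .
  qed
  then have "(\<Sum>i\<in>UNIV. \<Sum>j\<in>UNIV. \<Sum>k\<in>UNIV.
       - cell_integral L (\<lambda>x. pderiv_at j (w k) x * (pderiv_at j (w i) x * pderiv_at k (w i) x)))
    \<le> (\<Sum>i\<in>UNIV. \<Sum>j\<in>UNIV. \<Sum>k\<in>UNIV. G / 2 * (A i j + A i k))"
    by (intro sum_mono)
  also have "\<dots> = 3 * G * (\<Sum>i\<in>UNIV. \<Sum>j\<in>UNIV. A i j)"
    unfolding sum_distrib_left[symmetric] sum.distrib by (simp add: sum_distrib_left[symmetric])
  finally show ?thesis by (simp add: sum_negf A_def)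
qed

end

text \<open>Young's inequality with the weight \<open>\<tau>\<close>, chosen so that the right-hand side sums up to \<open>F\<^sub>n / (2 \<tau>)\<close>
  when \<open>a\<close> is a velocity and \<open>b\<close> a forcing.\<close>

lemma cell_integral_product_le:
  assumes a: "continuous_on UNIV a" and b: "continuous_on UNIV b" and \<tau>: "\<tau> > 0"
  shows "cell_integral L (\<lambda>x. a x * b x)
    \<le> (cell_integral L (\<lambda>x. (a x)\<^sup>2) + \<tau>\<^sup>2 * cell_integral L (\<lambda>x. (b x)\<^sup>2)) / (2 * \<tau>)"
proof -
  note c = continuous_integrable_on_cell continuous_intros a b
  have "2 * \<tau> * cell_integral L (\<lambda>x. a x * b x) = cell_integral L (\<lambda>x. 2 * \<tau> * (a x * b x))" by simp
  also have "\<dots> \<le> cell_integral L (\<lambda>x. (a x)\<^sup>2 + \<tau>\<^sup>2 * (b x)\<^sup>2)"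
  proof (rule integral_le)
    fix x
    have "0 \<le> (a x - \<tau> * b x)\<^sup>2" by simp
    then show "2 * \<tau> * (a x * b x) \<le> (a x)\<^sup>2 + \<tau>\<^sup>2 * (b x)\<^sup>2"
      by (simp add: power2_diff power_mult_distrib mult_ac)
  qed (intro c)+
  also have "\<dots> = cell_integral L (\<lambda>x. (a x)\<^sup>2) + \<tau>\<^sup>2 * cell_integral L (\<lambda>x. (b x)\<^sup>2)"
    by (subst integral_add) (intro c | simp)+
  finally show ?thesis using \<tau> by (simp add: field_simps)
qed

section \<open>Dependence on time\<close>

lemma cell_integral_square_derivative:
  assumes G: "smooth_on spacetime G" and t: "t \<ge> 0"
  shows "((\<lambda>t. cell_integral L (\<lambda>x. (G (x, t))\<^sup>2)) has_field_derivative
      2 * cell_integral L (\<lambda>x. G (x, t) * time_deriv G (x, t))) (at t within {0..})"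
proof -
  have sw: "continuous_on ({0..} \<times> A) (\<lambda>(t, x). h (x, t))"
    if "smooth_on spacetime h" for h :: "(real^3) \<times> real \<Rightarrow> real" and A
    unfolding case_prod_unfold
    by (rule continuous_on_compose2[OF smooth_on_imp_continuous_on[OF that]])
       (auto intro!: continuous_intros)
  have "((\<lambda>t. integral (cbox 0 (\<chi> i. L)) (\<lambda>x. (G (x, t))\<^sup>2)) has_field_derivative
      integral (cbox 0 (\<chi> i. L)) (\<lambda>x. 2 * (G (x, t) * time_deriv G (x, t)))) (at t within {0..})"
  proof (rule leibniz_rule_field_derivative)
    show "((\<lambda>t. (G (x, t))\<^sup>2) has_field_derivative 2 * (G (x, t) * time_deriv G (x, t))) (at t within {0..})"
      if "t \<in> {0..}" for t x
      using has_field_derivative_time_deriv[OF G, of t x] that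
      by (auto intro!: derivative_eq_intros)
    show "(\<lambda>x. (G (x, t))\<^sup>2) integrable_on cbox 0 (\<chi> i. L)" if "t \<in> {0..}" for t
      using continuous_integrable_on_cell[OF continuous_on_power[OF smooth_on_imp_continuous_on[OF smooth_on_slice[OF G]]]] that
      by (auto simp: torus_cell_def)
    show "continuous_on ({0..} \<times> cbox 0 (\<chi> i. L)) (\<lambda>(t, x). 2 * (G (x, t) * time_deriv G (x, t)))"
      using continuous_on_mult_left[OF continuous_on_mult[OF sw[OF G] sw[OF smooth_on_time_deriv[OF G]]], of _ 2]
      by (simp add: case_prod_unfold)
  qed (use t in auto)
  then show ?thesis by (simp add: torus_cell_def)
qed

lemma continuous_on_cell_integral_square:
  assumes "smooth_on spacetime G"
  shows "continuous_on {0..} (\<lambda>t. cell_integral L (\<lambda>x. (G (x, t))\<^sup>2))"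
  unfolding continuous_on_eq_continuous_within
  by (blast intro: DERIV_continuous cell_integral_square_derivative[OF assms])

lemma abs_le_sup_norm:
  assumes "continuous_on UNIV g" "x \<in> torus_cell L"
  shows "\<bar>g x\<bar> \<le> sup_norm L g"
  unfolding sup_norm_def
proof (rule cSUP_upper[OF assms(2)])
  have "continuous_on (torus_cell L) (\<lambda>x. \<bar>g x\<bar>)"
    by (intro continuous_intros continuous_on_subset[OF assms(1)]) auto
  then show "bdd_above ((\<lambda>x. \<bar>g x\<bar>) ` torus_cell L)"
    unfolding torus_cell_def
    by (intro bounded_imp_bdd_above compact_imp_bounded compact_continuous_image) auto
qed

lemma abs_pderiv_le_grad_sup_norm:
  assumes "smooth_on UNIV (\<lambda>x. v x $ i)" "x \<in> torus_cell L"
  shows "\<bar>pderiv_at j (\<lambda>x. v x $ i) x\<bar> \<le> grad_sup_norm L v"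
proof -
  have "\<bar>pderiv_at j (\<lambda>x. v x $ i) x\<bar> \<le> sup_norm L (pderiv_at j (\<lambda>x. v x $ i))"
    by (intro abs_le_sup_norm smooth_on_imp_continuous_on smooth_on_pderiv_at assms)
  also have "\<dots> \<le> grad_sup_norm L v"
    unfolding grad_sup_norm_def
    by (rule Max_ge) (auto intro!: image_eqI[where x="(i, j)"])
  finally show ?thesis .
qed

lemma torus_cell_nonempty: "L > 0 \<Longrightarrow> torus_cell L \<noteq> {}"
  unfolding torus_cell_def by (simp add: interval_ne_empty_cart)

lemma vec_sup_norm_le:
  assumes "L > 0" "\<And>i x. x \<in> torus_cell L \<Longrightarrow> \<bar>v x $ i\<bar> \<le> B"
  shows "vec_sup_norm L v \<le> B"
proof -
  have "sup_norm L (\<lambda>x. v x $ i) \<le> B" for i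
    unfolding sup_norm_def by (rule cSUP_least[OF torus_cell_nonempty[OF assms(1)] assms(2)])
  then show ?thesis unfolding vec_sup_norm_def by (subst Max_le_iff) auto
qed

text \<open>\<open>H\<close> is uniformly continuous on the compact set \<open>torus_cell L \<times> {0..t0+1}\<close>.\<close>

lemma continuous_on_sup_norm:
  assumes L: "L > 0" and H: "continuous_on spacetime H"
  shows "continuous_on {0..} (\<lambda>t. sup_norm L (\<lambda>x. H (x, t)))"
  unfolding continuous_on_iff
proof (intro ballI allI impI)
  fix t0 e :: real assume t0: "t0 \<in> {0..}" and e: "e > 0"
  have slice: "continuous_on UNIV (\<lambda>x. H (x, t))" if "t \<ge> 0" for t
    by (rule continuous_on_compose2[OF H]) (use that in \<open>auto intro!: continuous_intros\<close>)
  have "uniformly_continuous_on (torus_cell L \<times> {0..t0+1}) H"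
    by (intro compact_uniformly_continuous continuous_on_subset[OF H] compact_Times)
       (auto simp: torus_cell_def)
  then obtain d where d: "d > 0" and
    close: "\<And>z z'. z \<in> torus_cell L \<times> {0..t0+1} \<Longrightarrow> z' \<in> torus_cell L \<times> {0..t0+1} \<Longrightarrow>
        dist z' z < d \<Longrightarrow> dist (H z') (H z) < e / 2"
    using e unfolding uniformly_continuous_on_def by (meson half_gt_zero)
  have le: "sup_norm L (\<lambda>x. H (x, s)) \<le> sup_norm L (\<lambda>x. H (x, s')) + e / 2"
    if "s \<in> {0..t0+1}" "s' \<in> {0..t0+1}" "dist s s' < d" for s s'
    unfolding sup_norm_def[of L "\<lambda>x. H (x, s)"]
  proof (rule cSUP_least[OF torus_cell_nonempty[OF L]])
    fix x assume x: "x \<in> torus_cell L"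
    have "dist (H (x, s)) (H (x, s')) < e / 2"
      using that x by (intro close) (auto simp: dist_Pair_Pair)
    moreover have "\<bar>H (x, s')\<bar> \<le> sup_norm L (\<lambda>x. H (x, s'))"
      using that by (intro abs_le_sup_norm[OF slice x]) auto
    ultimately show "\<bar>H (x, s)\<bar> \<le> sup_norm L (\<lambda>x. H (x, s')) + e / 2"
      unfolding dist_real_def by linarith
  qed
  show "\<exists>d>0. \<forall>t\<in>{0..}. dist t t0 < d \<longrightarrow>
      dist (sup_norm L (\<lambda>x. H (x, t))) (sup_norm L (\<lambda>x. H (x, t0))) < e"
  proof (intro exI[of _ "min d 1"] conjI ballI impI)
    fix t assume t: "t \<in> {0..}" "dist t t0 < min d 1"
    then have "t \<in> {0..t0+1}" "t0 \<in> {0..t0+1}" "dist t t0 < d" "dist t0 t < d"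
      using t0 by (auto simp: dist_real_def)
    from le[OF this(1,2,3)] le[OF this(2,1,4)]
    show "dist (sup_norm L (\<lambda>x. H (x, t))) (sup_norm L (\<lambda>x. H (x, t0))) < e"
      using e unfolding dist_real_def by linarith
  qed (use d in auto)
qed

lemma continuous_on_Max_finite:
  fixes f :: "'i \<Rightarrow> 'a::topological_space \<Rightarrow> real"
  assumes "finite A" "A \<noteq> {}" "\<And>a. a \<in> A \<Longrightarrow> continuous_on S (f a)"
  shows "continuous_on S (\<lambda>t. Max ((\<lambda>a. f a t) ` A))"
  using assms
proof (induction A rule: finite_ne_induct)
  case (insert a A)
  then have "continuous_on S (\<lambda>t. max (f a t) (Max ((\<lambda>a. f a t) ` A)))"
    by (intro continuous_intros) auto
  then show ?case using insert by simp
qed simp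

lemma continuous_on_grad_sup_norm:
  assumes L: "L > 0" and u: "smooth_on spacetime (\<lambda>(x, t). u t x)"
  shows "continuous_on {0..} (\<lambda>t. grad_sup_norm L (u t))"
proof -
  have "continuous_on {0..} (\<lambda>t. sup_norm L (pderiv_at j (\<lambda>x. u t x $ i)))" for i j
    using continuous_on_sup_norm[OF L smooth_on_imp_continuous_on[OF
        smooth_on_spacetime_pderiv[OF smooth_on_spacetime_vec_nth[OF u, of i], of j]]]
    by simp
  then show ?thesis
    unfolding grad_sup_norm_def case_prod_unfold
    by (intro continuous_on_Max_finite) auto
qed

text \<open>Divide by \<open>\<Phi>\<close> and integrate the logarithmic derivative. As \<open>\<Phi>\<close> stays at least \<open>1\<close>, its logarithm at time
  \<open>T\<close> is nonnegative, so the average growth rate \<open>g - \<nu> Y\<close> cannot be negative in the long run.\<close>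

lemma mean_growth_rate_bound:
  fixes \<Phi> \<Phi>' Y g :: "real \<Rightarrow> real"
  assumes \<nu>: "\<nu> > 0" and T: "T \<ge> 0"
    and \<Phi>: "\<And>t. t \<ge> 0 \<Longrightarrow> \<Phi> t \<ge> 1"
    and der: "\<And>t. t \<ge> 0 \<Longrightarrow> (\<Phi> has_field_derivative \<Phi>' t) (at t within {0..})"
    and le: "\<And>t. t \<ge> 0 \<Longrightarrow> \<Phi>' t \<le> 2 * (g t - \<nu> * Y t) * \<Phi> t"
    and Y: "Y integrable_on {0..T}" and g: "g integrable_on {0..T}"
  shows "\<nu> * integral {0..T} Y \<le> integral {0..T} g + ln (\<Phi> 0) / 2"
proof -
  have "((\<lambda>t. \<Phi>' t / \<Phi> t) has_integral (ln (\<Phi> T) - ln (\<Phi> 0))) {0..T}"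
  proof (rule fundamental_theorem_of_calculus[OF T])
    fix t assume t: "t \<in> {0..T}"
    then have "((\<lambda>t. ln (\<Phi> t)) has_field_derivative (1 / \<Phi> t) * \<Phi>' t) (at t within {0..T})"
      using \<Phi>[of t]
      by (intro DERIV_chain2[OF DERIV_ln_divide] has_field_derivative_subset[OF der]) auto
    then show "((\<lambda>t. ln (\<Phi> t)) has_vector_derivative \<Phi>' t / \<Phi> t) (at t within {0..T})"
      by (simp add: has_real_derivative_iff_has_vector_derivative)
  qed
  moreover have "((\<lambda>t. 2 * (g t - \<nu> * Y t)) has_integral
      2 * (integral {0..T} g - \<nu> * integral {0..T} Y)) {0..T}"
    by (intro has_integral_mult_right has_integral_diff integrable_integral Y g)
  ultimately have "ln (\<Phi> T) - ln (\<Phi> 0) \<le> 2 * (integral {0..T} g - \<nu> * integral {0..T} Y)"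
  proof (rule has_integral_le)
    fix t assume "t \<in> {0..T}"
    then show "\<Phi>' t / \<Phi> t \<le> 2 * (g t - \<nu> * Y t)"
      using \<Phi>[of t] le[of t] by (simp add: pos_divide_le_eq)
  qed
  moreover have "ln (\<Phi> T) \<ge> 0" using \<Phi>[OF T] by simp
  ultimately show ?thesis by simp
qed

section \<open>The ladder inequalities\<close>

lemma momentum_balance_NS:
  assumes L: "L > 0" and \<nu>: "\<nu> > 0" and f: "smooth_on UNIV f" "periodic L f"
    and NS: "smooth_periodic_NS_solution L \<nu> f u0 u p" and t: "t \<ge> 0"
  shows "momentum_balance L \<nu> (\<lambda>i x. u t x $ i) (\<lambda>i x. time_deriv (\<lambda>(x, t). u t x $ i) (x, t))
      (\<lambda>i x. f x $ i) (p t)"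
proof -
  let ?w = "\<lambda>i x. u t x $ i" and ?V = "\<lambda>i x. time_deriv (\<lambda>(x, t). u t x $ i) (x, t)"
  have smu: "smooth_on spacetime (\<lambda>(x, t). u t x)" and smp: "smooth_on spacetime (\<lambda>(x, t). p t x)"
    and per: "periodic L (u t)" "periodic L (p t)"
    and mom: "\<And>x i. vector_derivative (\<lambda>s. u s x $ i) (at t within {0..})
          + (\<Sum>j\<in>UNIV. u t x $ j * pderiv_at j (\<lambda>y. u t y $ i) x)
        = \<nu> * (\<Sum>j\<in>UNIV. pderiv_at j (pderiv_at j (\<lambda>y. u t y $ i)) x)
          - pderiv_at i (p t) x + f x $ i"
    and div: "\<And>x. (\<Sum>j\<in>UNIV. pderiv_at j (\<lambda>y. u t y $ j) x) = 0"
    using NS t unfolding smooth_periodic_NS_solution_def by blast+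
  note smui = smooth_on_spacetime_vec_nth[OF smu]
  have w: "smooth_on UNIV (?w i)" "periodic L (?w i)" for i
    using smooth_on_slice[OF smui t, of i] per(1) by (auto simp: periodic_def)
  have F: "smooth_on UNIV (\<lambda>x. f x $ i)" "periodic L (\<lambda>x. f x $ i)" for i
    using smooth_on_UNIV_vec_nth[OF f(1)] f(2) by (auto simp: periodic_def)
  have p: "smooth_on UNIV (p t)" using smooth_on_slice[OF smp t] by simp
  have eq: "?V i x + (\<Sum>k\<in>UNIV. ?w k x * pderiv_at k (?w i) x)
      = \<nu> * (\<Sum>k\<in>UNIV. pderiv_at k (pderiv_at k (?w i)) x) - pderiv_at i (p t) x + f x $ i" for i x
    using mom[of x i] by (simp add: time_deriv_def)
  \<comment> \<open>every other term of the momentum equation is periodic\<close>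
  have "periodic L (?V i)" for i
  proof -
    have V: "?V i x = \<nu> * (\<Sum>k\<in>UNIV. pderiv_at k (pderiv_at k (?w i)) x) - pderiv_at i (p t) x + f x $ i
        - (\<Sum>k\<in>UNIV. ?w k x * pderiv_at k (?w i) x)" for x
      using eq[of i x] by simp
    have "h (x + L *\<^sub>R axis j 1) = h x" if "periodic L h" for h :: "real^3 \<Rightarrow> real" and x j
      using that by (simp add: periodic_def)
    note shift = this[OF w(2)] this[OF periodic_pderiv_at[OF w(2)]]
      this[OF periodic_pderiv_at[OF periodic_pderiv_at[OF w(2)]]] this[OF F(2)]
      this[OF periodic_pderiv_at[OF per(2)]]
    show ?thesis unfolding periodic_def V by (intro allI) (simp only: shift)
  qed
  moreover have "smooth_on UNIV (?V i)" for i
    by (rule smooth_on_slice[OF smooth_on_time_deriv[OF smui] t])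
  ultimately show ?thesis
    using L \<nu> w F p per(2) eq div by unfold_locales auto
qed

lemma length_scales:
  assumes L: "L > 0"
    and bdd: "bdd_above (range (\<lambda>n. deriv_energy L (Suc n) f / deriv_energy L n f))"
    and pos: "deriv_energy L 0 f > 0" "deriv_energy L 1 f > 0"
  obtains \<Lambda> where "\<Lambda> > 0" "deriv_energy L 1 f \<le> \<Lambda> * deriv_energy L 0 f"
    "deriv_energy L 2 f \<le> \<Lambda> * deriv_energy L 1 f"
    "length0 L f powi (-2) = \<Lambda> + 1 / L\<^sup>2"
    "length0 L f powr (-3/4) = (\<Lambda> + 1 / L\<^sup>2) powr (3/8)"
proof -
  define \<Lambda> where "\<Lambda> = (SUP n. deriv_energy L (Suc n) f / deriv_energy L n f)"
  have le: "deriv_energy L (Suc n) f / deriv_energy L n f \<le> \<Lambda>" for n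
    unfolding \<Lambda>_def by (rule cSUP_upper[OF UNIV_I bdd])
  have pos\<Lambda>: "\<Lambda> > 0"
    using le[of 0] pos by (smt (verit) One_nat_def divide_pos_pos)
  define a where "a = \<Lambda> + 1 / L\<^sup>2"
  have a: "a > 0" unfolding a_def using pos\<Lambda> L by (simp add: add_pos_pos)
  have "forcing_length L f powi (-2) = \<Lambda>"
    using pos\<Lambda> by (simp add: forcing_length_def \<Lambda>_def[symmetric] power_int_minus power_divide)
  then have l0: "length0 L f = 1 / sqrt a"
    by (simp add: length0_def a_def power_int_minus inverse_eq_divide)
  show ?thesis
  proof (rule that[OF pos\<Lambda>])
    show "deriv_energy L 1 f \<le> \<Lambda> * deriv_energy L 0 f"
      using le[of 0] pos by (simp add: pos_divide_le_eq)
    show "deriv_energy L 2 f \<le> \<Lambda> * deriv_energy L 1 f"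
      using le[of 1] pos by (simp add: pos_divide_le_eq numeral_2_eq_2)
    show "length0 L f powi (-2) = \<Lambda> + 1 / L\<^sup>2"
      unfolding l0 a_def[symmetric] using a by (simp add: power_int_minus power_divide)
    have "1 / sqrt a = a powr (-(1/2))"
      using a by (simp add: powr_minus_divide powr_half_sqrt)
    then show "length0 L f powr (-3/4) = (\<Lambda> + 1 / L\<^sup>2) powr (3/8)"
      unfolding l0 a_def[symmetric] by (simp add: powr_powr)
  qed
qed

text \<open>The energy balance, with \<open>J\<^sub>1\<close> completed to \<open>F\<^sub>1\<close> at the price of \<open>\<tau>\<^sup>2 \<Phi>\<^sub>1 \<le> \<Lambda> \<tau>\<^sup>2 \<Phi>\<^sub>0\<close>. The work of the forcing costs
  \<open>F\<^sub>0 / (2 \<tau>)\<close>, and \<open>1 / \<tau> = \<nu> / L\<^sup>2\<close>.\<close>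

lemma energy_ladder_0:
  assumes mb: "momentum_balance L \<nu> (\<lambda>i x. v x $ i) V (\<lambda>i x. f x $ i) p"
    and \<Lambda>: "\<Lambda> > 0" "deriv_energy L 1 f \<le> \<Lambda> * deriv_energy L 0 f"
  shows "(\<Sum>i\<in>UNIV. 2 * cell_integral L (\<lambda>x. v x $ i * V i x))
    \<le> 2 * (\<nu> * (\<Lambda> + 1 / L\<^sup>2) * forced_energy L \<nu> f 0 v - \<nu> * forced_energy L \<nu> f 1 v)"
proof -
  interpret momentum_balance L \<nu> "\<lambda>i x. v x $ i" V "\<lambda>i x. f x $ i" p by (rule mb)
  define \<tau> where "\<tau> = visc_time L \<nu>"
  have \<tau>: "\<tau> > 0" unfolding \<tau>_def visc_time_def using L \<nu> by simp
  have E: "forced_energy L \<nu> f n v = deriv_energy L n v + \<tau>\<^sup>2 * deriv_energy L n f" for n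
    by (simp add: forced_energy_def \<tau>_def)
  have "(\<Sum>i\<in>UNIV. cell_integral L (\<lambda>x. v x $ i * f x $ i))
    \<le> (\<Sum>i\<in>UNIV. (cell_integral L (\<lambda>x. (v x $ i)\<^sup>2) + \<tau>\<^sup>2 * cell_integral L (\<lambda>x. (f x $ i)\<^sup>2)) / (2 * \<tau>))"
    by (intro sum_mono cell_integral_product_le smooth_on_imp_continuous_on w F \<tau>)
  also have "\<dots> = forced_energy L \<nu> f 0 v / (2 * \<tau>)"
    unfolding E deriv_energy_0 by (simp add: sum_divide_distrib[symmetric] sum.distrib sum_distrib_left)
  also have "\<dots> \<le> \<nu> * (1 / L\<^sup>2) * forced_energy L \<nu> f 0 v"
  proof -
    have "forced_energy L \<nu> f 0 v \<ge> 0" unfolding E by (simp add: deriv_energy_nonneg)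
    then show ?thesis using L \<nu> by (simp add: \<tau>_def visc_time_def field_simps)
  qed
  finally have 1: "(\<Sum>i\<in>UNIV. cell_integral L (\<lambda>x. v x $ i * f x $ i))
      \<le> \<nu> * (1 / L\<^sup>2) * forced_energy L \<nu> f 0 v" .
  have "\<tau>\<^sup>2 * deriv_energy L 1 f \<le> \<tau>\<^sup>2 * (\<Lambda> * deriv_energy L 0 f)"
    using \<Lambda>(2) by (intro mult_left_mono) auto
  also have "\<dots> \<le> \<Lambda> * forced_energy L \<nu> f 0 v"
    unfolding E using \<Lambda>(1) deriv_energy_nonneg[of L 0 v] by (simp add: algebra_simps)
  finally have 2: "\<nu> * (\<tau>\<^sup>2 * deriv_energy L 1 f) \<le> \<nu> * (\<Lambda> * forced_energy L \<nu> f 0 v)"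
    using \<nu> by (intro mult_left_mono) auto
  have "(\<Sum>i\<in>UNIV. cell_integral L (\<lambda>x. v x $ i * V i x))
      \<le> - \<nu> * deriv_energy L 1 v + \<nu> * (1 / L\<^sup>2) * forced_energy L \<nu> f 0 v"
    using energy_balance 1 unfolding deriv_energy_1 by simp
  also have "\<dots> \<le> \<nu> * (\<Lambda> + 1 / L\<^sup>2) * forced_energy L \<nu> f 0 v - \<nu> * forced_energy L \<nu> f 1 v"
    using 2 unfolding E[of 1] by (simp add: algebra_simps)
  finally show ?thesis by (simp add: sum_distrib_left[symmetric])
qed

text \<open>The same one derivative higher, where vortex stretching contributes \<open>3 * grad_sup_norm L v\<close>.\<close>

lemma energy_ladder_1:
  assumes mb: "momentum_balance L \<nu> (\<lambda>i x. v x $ i) V (\<lambda>i x. f x $ i) p"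
    and \<Lambda>: "\<Lambda> > 0" "deriv_energy L 2 f \<le> \<Lambda> * deriv_energy L 1 f"
  shows "(\<Sum>i\<in>UNIV. \<Sum>j\<in>UNIV. 2 * cell_integral L (\<lambda>x. pderiv_at j (\<lambda>x. v x $ i) x * pderiv_at j (V i) x))
    \<le> 2 * ((3 * grad_sup_norm L v + \<nu> * (\<Lambda> + 1 / L\<^sup>2)) * forced_energy L \<nu> f 1 v
        - \<nu> * forced_energy L \<nu> f 2 v)"
proof -
  interpret momentum_balance L \<nu> "\<lambda>i x. v x $ i" V "\<lambda>i x. f x $ i" p by (rule mb)
  define G where "G = grad_sup_norm L v"
  define \<tau> where "\<tau> = visc_time L \<nu>"
  have \<tau>: "\<tau> > 0" unfolding \<tau>_def visc_time_def using L \<nu> by simp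
  have E: "forced_energy L \<nu> f n v = deriv_energy L n v + \<tau>\<^sup>2 * deriv_energy L n f" for n
    by (simp add: forced_energy_def \<tau>_def)
  have "(\<Sum>i\<in>UNIV. \<Sum>j\<in>UNIV. cell_integral L (\<lambda>x. pderiv_at j (\<lambda>x. v x $ i) x * pderiv_at j (\<lambda>x. f x $ i) x))
    \<le> (\<Sum>i\<in>UNIV. \<Sum>j\<in>UNIV. (cell_integral L (\<lambda>x. (pderiv_at j (\<lambda>x. v x $ i) x)\<^sup>2)
        + \<tau>\<^sup>2 * cell_integral L (\<lambda>x. (pderiv_at j (\<lambda>x. f x $ i) x)\<^sup>2)) / (2 * \<tau>))"
    by (intro sum_mono cell_integral_product_le smooth_on_imp_continuous_on smooth_on_pderiv_at w F \<tau>)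
  also have "\<dots> = forced_energy L \<nu> f 1 v / (2 * \<tau>)"
    unfolding E deriv_energy_1 by (simp add: sum_divide_distrib[symmetric] sum.distrib sum_distrib_left)
  also have "\<dots> \<le> \<nu> * (1 / L\<^sup>2) * forced_energy L \<nu> f 1 v"
  proof -
    have "forced_energy L \<nu> f 1 v \<ge> 0" unfolding E by (simp add: deriv_energy_nonneg)
    then show ?thesis using L \<nu> by (simp add: \<tau>_def visc_time_def field_simps)
  qed
  finally have 1: "(\<Sum>i\<in>UNIV. \<Sum>j\<in>UNIV. cell_integral L
        (\<lambda>x. pderiv_at j (\<lambda>x. v x $ i) x * pderiv_at j (\<lambda>x. f x $ i) x))
      \<le> \<nu> * (1 / L\<^sup>2) * forced_energy L \<nu> f 1 v" .
  have "\<tau>\<^sup>2 * deriv_energy L 2 f \<le> \<tau>\<^sup>2 * (\<Lambda> * deriv_energy L 1 f)"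
    using \<Lambda>(2) by (intro mult_left_mono) auto
  also have "\<dots> \<le> \<Lambda> * forced_energy L \<nu> f 1 v"
    unfolding E using \<Lambda>(1) deriv_energy_nonneg[of L 1 v] by (simp add: algebra_simps)
  finally have 2: "\<nu> * (\<tau>\<^sup>2 * deriv_energy L 2 f) \<le> \<nu> * (\<Lambda> * forced_energy L \<nu> f 1 v)"
    using \<nu> by (intro mult_left_mono) auto
  have G: "\<bar>pderiv_at j (\<lambda>x. v x $ i) x\<bar> \<le> G" if "x \<in> torus_cell L" for i j x
    unfolding G_def by (rule abs_pderiv_le_grad_sup_norm[OF w(1) that])
  obtain x0 where "x0 \<in> torus_cell L" using torus_cell_nonempty[OF L] by auto
  from G[OF this, of 1 1] have "G \<ge> 0" by linarith
  have "deriv_energy L 1 v \<le> forced_energy L \<nu> f 1 v"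
    unfolding E by (simp add: deriv_energy_nonneg)
  with \<open>G \<ge> 0\<close> have 3: "3 * G * deriv_energy L 1 v \<le> 3 * G * forced_energy L \<nu> f 1 v"
    by (intro mult_left_mono) auto
  have "(\<Sum>i\<in>UNIV. \<Sum>j\<in>UNIV. cell_integral L (\<lambda>x. pderiv_at j (\<lambda>x. v x $ i) x * pderiv_at j (V i) x))
      \<le> - \<nu> * deriv_energy L 2 v + 3 * G * deriv_energy L 1 v + \<nu> * (1 / L\<^sup>2) * forced_energy L \<nu> f 1 v"
    using enstrophy_balance vortex_stretching_bound[OF G] 1
    unfolding deriv_energy_1 deriv_energy_2[of v, OF w(1)] by linarith
  also have "\<dots> \<le> (3 * G + \<nu> * (\<Lambda> + 1 / L\<^sup>2)) * forced_energy L \<nu> f 1 v - \<nu> * forced_energy L \<nu> f 2 v"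
    using 2 3 unfolding E[of 2] by (simp add: algebra_simps)
  finally show ?thesis by (simp add: sum_distrib_left[symmetric] G_def)
qed

text \<open>Agmon's inequality for the crest factor. With \<open>q = F\<^sub>2 / F\<^sub>0\<close>, the pointwise bound at the scale \<open>r\<close> reads
  \<open>7 * r powr (-3/2) + 18 * L\<^sup>2 * r powr (1/2) * sqrt q\<close>; the two powers balance at \<open>r = q powr (-1/4)\<close>, which is
  admissible for \<open>q > 1\<close>. Otherwise \<open>r = 1\<close> gives a constant.\<close>

lemma crest_factor_le:
  assumes L: "L > 0" and v: "\<And>i. smooth_on UNIV (\<lambda>x. v x $ i)" and F0: "forced_energy L \<nu> f 0 v > 0"
  shows "crest_factor L \<nu> f v
    \<le> (7 + 18 * L\<^sup>2) * ((forced_energy L \<nu> f 2 v / forced_energy L \<nu> f 0 v) powr (3/8) + 1)"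
proof -
  define A where "A = forced_energy L \<nu> f 0 v"
  define B where "B = forced_energy L \<nu> f 2 v"
  define q where "q = B / A"
  define K where "K = 7 + 18 * L\<^sup>2"
  have A: "A > 0" using F0 by (simp add: A_def)
  have EA: "deriv_energy L 0 v \<le> A" and EB: "deriv_energy L 2 v \<le> B"
    by (simp_all add: A_def B_def forced_energy_def deriv_energy_nonneg)
  have "B \<ge> 0" using EB deriv_energy_nonneg[of L 2 v] by linarith
  then have q: "q \<ge> 0" using A by (simp add: q_def)
  note c = continuous_integrable_on_cell continuous_intros smooth_on_imp_continuous_on smooth_on_pderiv_at v
  have nn: "0 \<le> cell_integral L (\<lambda>x. (v x $ i)\<^sup>2)"
    "0 \<le> cell_integral L (\<lambda>x. (pderiv_at j (pderiv_at k (\<lambda>x. v x $ i)) x)\<^sup>2)" for i j k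
    by (rule integral_nonneg, intro c, simp)+
  have bound: "\<bar>v x $ i\<bar> \<le> (7 * L powr (-3/2) * r powr (-3/2) + 18 * L powr (1/2) * r powr (1/2) * sqrt q) * sqrt A"
    if x: "x \<in> torus_cell L" and r: "0 < r" "r \<le> 1" for x i r
  proof -
    let ?N = "cell_integral L (\<lambda>x. (v x $ i)\<^sup>2)"
    let ?D = "\<Sum>j\<in>UNIV. \<Sum>k\<in>UNIV. cell_integral L (\<lambda>x. (pderiv_at j (pderiv_at k (\<lambda>x. v x $ i)) x)\<^sup>2)"
    have "?N \<le> deriv_energy L 0 v"
      unfolding deriv_energy_0
      by (rule member_le_sum[where f="\<lambda>i. cell_integral L (\<lambda>x. (v x $ i)\<^sup>2)"]) (auto intro!: nn)
    moreover have "?D \<le> deriv_energy L 2 v"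
      unfolding deriv_energy_2[OF v]
      by (rule member_le_sum[where f="\<lambda>i. \<Sum>j\<in>UNIV. \<Sum>k\<in>UNIV.
            cell_integral L (\<lambda>x. (pderiv_at j (pderiv_at k (\<lambda>x. v x $ i)) x)\<^sup>2)"])
         (auto intro!: sum_nonneg nn)
    ultimately have ND: "sqrt ?N \<le> sqrt A" "sqrt ?D \<le> sqrt B" using EA EB by auto
    have "\<bar>v x $ i\<bar> \<le> 7 * L powr (-3/2) * r powr (-3/2) * sqrt ?N + 18 * L powr (1/2) * r powr (1/2) * sqrt ?D"
      by (rule pointwise_bound_torus[OF L x r v])
    also have "\<dots> \<le> 7 * L powr (-3/2) * r powr (-3/2) * sqrt A + 18 * L powr (1/2) * r powr (1/2) * sqrt B"
      by (intro add_mono mult_left_mono ND) auto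
    also have "sqrt B = sqrt q * sqrt A"
      using A by (simp add: q_def real_sqrt_divide)
    finally show ?thesis by (simp add: algebra_simps)
  qed
  have crest: "crest_factor L \<nu> f v \<le> 7 * r powr (-3/2) + 18 * L\<^sup>2 * (r powr (1/2) * sqrt q)"
    if r: "0 < r" "r \<le> 1" for r
  proof -
    have "vec_sup_norm L v
        \<le> (7 * L powr (-3/2) * r powr (-3/2) + 18 * L powr (1/2) * r powr (1/2) * sqrt q) * sqrt A"
      by (intro vec_sup_norm_le L bound r)
    then have "L powr (3/2) * vec_sup_norm L v / sqrt A
        \<le> L powr (3/2) * ((7 * L powr (-3/2) * r powr (-3/2) + 18 * L powr (1/2) * r powr (1/2) * sqrt q) * sqrt A) / sqrt A"
      using A by (intro divide_right_mono mult_left_mono) auto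
    also have "\<dots> = L powr (3/2) * (7 * L powr (-3/2) * r powr (-3/2) + 18 * L powr (1/2) * r powr (1/2) * sqrt q)"
      using A by simp
    also have "\<dots> = 7 * (L powr (3/2) * L powr (-3/2)) * r powr (-3/2)
        + 18 * (L powr (3/2) * L powr (1/2)) * (r powr (1/2) * sqrt q)"
      by (simp add: algebra_simps)
    also have "\<dots> = 7 * r powr (-3/2) + 18 * L\<^sup>2 * (r powr (1/2) * sqrt q)"
      unfolding powr_add[symmetric] using L by simp
    finally show ?thesis
      using A by (simp add: crest_factor_def A_def[symmetric] powr_half_sqrt)
  qed
  have "crest_factor L \<nu> f v \<le> K * (q powr (3/8) + 1)"
  proof (cases "q \<le> 1")
    case True
    then have "sqrt q \<le> 1" by simp
    then have "18 * L\<^sup>2 * sqrt q \<le> 18 * L\<^sup>2 * 1" by (intro mult_left_mono) auto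
    then have "crest_factor L \<nu> f v \<le> K" using crest[of 1] by (simp add: K_def)
    also have "\<dots> \<le> K * (q powr (3/8) + 1)" by (simp add: K_def algebra_simps)
    finally show ?thesis .
  next
    case False
    then have q1: "q > 1" by simp
    have "q powr (-1/4) \<le> 1" using q1 powr_mono[of "-1/4" 0 q] by simp
    then have "crest_factor L \<nu> f v \<le> 7 * (q powr (-1/4)) powr (-3/2)
        + 18 * L\<^sup>2 * ((q powr (-1/4)) powr (1/2) * q powr (1/2))"
      using crest[of "q powr (-1/4)"] q1 by (simp add: powr_half_sqrt)
    also have "\<dots> = K * q powr (3/8)"
      unfolding powr_powr powr_add[symmetric] by (simp add: K_def algebra_simps)
    also have "\<dots> \<le> K * (q powr (3/8) + 1)" by (intro mult_left_mono) (auto simp: K_def)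
    finally show ?thesis .
  qed
  then show ?thesis by (simp add: q_def A_def B_def K_def)
qed

text \<open>An affine majorant, scaled to the reference values \<open>a\<close> and \<open>b\<close>, takes the place of Hoelder's inequality
  when averages over time are taken.\<close>

lemma powr_product_le_affine:
  fixes X Y a b :: real
  assumes "X \<ge> 0" "Y \<ge> 0" "a > 0" "b > 0"
  shows "(X * Y) powr (3/8) \<le> a powr (3/8) * b powr (3/8) * (1 + X / a + Y / b)"
proof -
  define P where "P = X / a"
  define Q where "Q = Y / b"
  have PQ: "P \<ge> 0" "Q \<ge> 0" using assms by (auto simp: P_def Q_def)
  define M where "M = 1 + P + Q"
  have M: "M \<ge> 1" "P \<le> M" "Q \<le> M" using PQ by (auto simp: M_def)
  have "(P * Q) powr (3/8) \<le> (M * M) powr (3/8)"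
    using PQ M by (intro powr_mono2 mult_mono) auto
  also have "\<dots> = M powr (3/4)" using M by (simp add: powr_mult powr_add[symmetric])
  also have "\<dots> \<le> M" using M powr_mono[of "3/4" 1 M] by simp
  finally have *: "(P * Q) powr (3/8) \<le> M" .
  have "(X * Y) powr (3/8) = (a * b * (P * Q)) powr (3/8)"
    using assms by (simp add: P_def Q_def)
  also have "\<dots> = a powr (3/8) * b powr (3/8) * (P * Q) powr (3/8)"
    using assms PQ by (simp add: powr_mult)
  also have "\<dots> \<le> a powr (3/8) * b powr (3/8) * M" using * by (intro mult_left_mono) auto
  finally show ?thesis by (simp add: M_def P_def Q_def)
qed

section \<open>Long-time averages\<close>

definition running_mean :: "(real \<Rightarrow> real) \<Rightarrow> real \<Rightarrow> real" where
  "running_mean g T = 1 / T * integral {0..T} g"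

lemma time_average_bounded:
  assumes g: "continuous_on {0..} g" "\<And>t. t \<ge> 0 \<Longrightarrow> 0 \<le> g t" "\<And>t. t \<ge> 0 \<Longrightarrow> g t \<le> B"
  shows "0 \<le> real_of_ereal (time_average g)"
    and "\<delta> > 0 \<Longrightarrow> \<forall>\<^sub>F T in at_top. running_mean g T \<le> real_of_ereal (time_average g) + \<delta>"
proof -
  have int: "g integrable_on {0..T}" for T
    by (intro integrable_continuous_real continuous_on_subset[OF g(1)]) auto
  have lower: "0 \<le> running_mean g T" and upper: "running_mean g T \<le> B" if "T > 0" for T
  proof -
    show "0 \<le> running_mean g T"
      unfolding running_mean_def using that g(2)
      by (intro mult_nonneg_nonneg integral_nonneg int) auto
    have "integral {0..T} g \<le> integral {0..T} (\<lambda>t. B)"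
      using g(3) by (intro integral_le int) auto
    then show "running_mean g T \<le> B" unfolding running_mean_def using that by (simp add: field_simps)
  qed
  have ta: "time_average g = Limsup at_top (\<lambda>T. ereal (running_mean g T))"
    by (simp add: time_average_def running_mean_def)
  have pos: "\<forall>\<^sub>F T in at_top. T > (0::real)" by (rule eventually_gt_at_top)
  have "ereal 0 \<le> time_average g"
    unfolding ta by (rule le_Limsup) (auto intro: eventually_mono[OF pos] lower)
  moreover have "time_average g \<le> ereal B"
    unfolding ta by (rule Limsup_bounded) (auto intro: eventually_mono[OF pos] upper)
  ultimately obtain m where m: "time_average g = ereal m" "m \<ge> 0"
    by (cases "time_average g") auto
  then show "0 \<le> real_of_ereal (time_average g)" by simp
  show "\<forall>\<^sub>F T in at_top. running_mean g T \<le> real_of_ereal (time_average g) + \<delta>" if "\<delta> > 0"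
  proof -
    have "Limsup at_top (\<lambda>T. ereal (running_mean g T)) < ereal (m + \<delta>)"
      using m that unfolding ta by simp
    then show ?thesis using m by (auto dest!: Limsup_lessD elim!: eventually_mono)
  qed
qed

lemma time_average_leI:
  assumes "\<forall>\<^sub>F T in at_top. running_mean g T \<le> C"
  shows "time_average g \<le> ereal C"
  unfolding time_average_def
  by (rule Limsup_bounded) (use assms in \<open>auto simp: running_mean_def elim!: eventually_mono\<close>)

lemma eventually_const_over_le:
  assumes "\<epsilon> > 0"
  shows "\<forall>\<^sub>F T in at_top. c / T \<le> (\<epsilon>::real)"
proof -
  have "((\<lambda>T. c / T) \<longlongrightarrow> 0) at_top" 
    by (intro tendsto_divide_0[OF tendsto_const] filterlim_at_top_imp_at_infinity filterlim_ident)
  then have "\<forall>\<^sub>F T in at_top. c / T < \<epsilon>" using assms by (rule order_tendstoD)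
  then show ?thesis by (rule eventually_mono) simp
qed

text \<open>With \<open>X = F\<^sub>1 / F\<^sub>0\<close> and \<open>Y = F\<^sub>2 / F\<^sub>1\<close>, the ladder inequalities bound the long-time means of \<open>X\<close> by \<open>a\<close> and of \<open>Y\<close> by \<open>b\<close>.
  For large times the running means are thus below \<open>2 * a\<close> and \<open>2 * b\<close>, and the affine majorant of
  \<open>(X * Y) powr (3/8)\<close> has a mean of at most \<open>5\<close> times \<open>a powr (3/8) * b powr (3/8)\<close>. The additive constant in the bound
  of \<open>C\<close> is absorbed through \<open>one\<close>.\<close>

lemma crest_average_combination:
  fixes X Y G C :: "real \<Rightarrow> real"
  assumes \<nu>: "\<nu> > 0" and a: "a > 0" and \<kappa>: "\<kappa> \<ge> 0" and K: "K \<ge> 0"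
    and X: "continuous_on {0..} X" "\<And>t. t \<ge> 0 \<Longrightarrow> 0 \<le> X t"
    and Y: "continuous_on {0..} Y" "\<And>t. t \<ge> 0 \<Longrightarrow> 0 \<le> Y t"
    and G: "continuous_on {0..} G" "\<And>t. t \<ge> 0 \<Longrightarrow> 0 \<le> G t" "\<And>t. t \<ge> 0 \<Longrightarrow> G t \<le> B"
    and meanX: "\<And>T. T \<ge> 0 \<Longrightarrow> \<nu> * integral {0..T} X \<le> integral {0..T} (\<lambda>t. \<nu> * a) + kx"
    and meanY: "\<And>T. T \<ge> 0 \<Longrightarrow> \<nu> * integral {0..T} Y \<le> integral {0..T} (\<lambda>t. 3 * G t + \<nu> * a) + ky"
    and b: "b = 3 * (1 / \<nu>) * real_of_ereal (time_average G) + a"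
    and one: "1 \<le> \<kappa> * (a powr (3/8) * b powr (3/8))"
    and C: "\<And>t. t \<ge> 0 \<Longrightarrow> C t \<le> K * ((X t * Y t) powr (3/8) + 1)"
  shows "time_average C \<le> ereal (K * (\<kappa> + 5) * (a powr (3/8) * b powr (3/8)))"
proof -
  define m where "m = real_of_ereal (time_average G)"
  define P where "P = a powr (3/8) * b powr (3/8)"
  have m: "m \<ge> 0" unfolding m_def by (rule time_average_bounded(1)[OF G])
  have b: "b = 3 * m / \<nu> + a" using b by (simp add: m_def)
  have bpos: "b > 0" unfolding b using m \<nu> a by (intro add_nonneg_pos) auto
  have P: "P \<ge> 0" by (simp add: P_def)
  have ints: "X integrable_on {0..T}" "Y integrable_on {0..T}" "G integrable_on {0..T}" for T
    by (intro integrable_continuous_real continuous_on_subset[OF X(1)]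
         continuous_on_subset[OF Y(1)] continuous_on_subset[OF G(1)]; auto)+
  have evX: "\<forall>\<^sub>F T in at_top. running_mean X T \<le> 2 * a"
    using eventually_const_over_le[OF a, of "kx / \<nu>"] eventually_gt_at_top[of 0]
  proof eventually_elim
    case (elim T)
    have "integral {0..T} X \<le> T * a + kx / \<nu>"
      using meanX[of T] elim \<nu> by (simp add: field_simps)
    then have "running_mean X T \<le> a + kx / \<nu> / T"
      using elim by (simp add: running_mean_def field_simps)
    then show ?case using elim by simp
  qed
  \<comment> \<open>the mean of \<open>G\<close>, which enters with the factor \<open>3 / \<nu>\<close>, and the initial term \<open>ky\<close> may each add \<open>b / 2\<close>\<close>
  have half: "b / 2 > 0" "\<nu> * b / 6 > 0" using bpos \<nu> by auto
  have evG: "\<forall>\<^sub>F T in at_top. running_mean G T \<le> m + \<nu> * b / 6"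
    unfolding m_def by (rule time_average_bounded(2)[OF G]) (use half in auto)
  have evY: "\<forall>\<^sub>F T in at_top. running_mean Y T \<le> 2 * b"
    using eventually_const_over_le[OF half(1), of "ky / \<nu>"] eventually_gt_at_top[of 0]
      evG
  proof eventually_elim
    case (elim T)
    have "integral {0..T} (\<lambda>t. 3 * G t + \<nu> * a) = 3 * integral {0..T} G + T * (\<nu> * a)"
      using ints(3)[of T] elim by (subst integral_add) (auto intro: integrable_on_cmult_left)
    with meanY[of T] elim \<nu> have "integral {0..T} Y \<le> 3 / \<nu> * integral {0..T} G + T * a + ky / \<nu>"
      by (simp add: field_simps)
    then have "running_mean Y T \<le> 3 / \<nu> * running_mean G T + a + ky / \<nu> / T"
      using elim \<nu> by (simp add: running_mean_def field_simps)
    also have "\<dots> \<le> 3 / \<nu> * (m + \<nu> * b / 6) + a + b / 2"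
      using elim \<nu> by (intro add_mono mult_left_mono) auto
    also have "\<dots> = 2 * b" using \<nu> unfolding b by (simp add: field_simps)
    finally show ?case .
  qed
  have "\<forall>\<^sub>F T in at_top. running_mean C T \<le> K * (\<kappa> + 5) * P"
    using evX evY eventually_gt_at_top[of 0]
  proof eventually_elim
    case (elim T)
    show ?case
    proof (cases "C integrable_on {0..T}")
      \<comment> \<open>the integral of a non-integrable function is \<open>0\<close> by convention\<close>
      case False
      then show ?thesis using K \<kappa> P by (simp add: running_mean_def not_integrable_integral)
    next
      case True
      have affine: "((\<lambda>t. K * P * (\<kappa> + 1 + X t / a + Y t / b)) has_integral
          K * P * (T * (\<kappa> + 1) + integral {0..T} X / a + integral {0..T} Y / b)) {0..T}"
      proof -
        have "((\<lambda>t. \<kappa> + 1) has_integral T * (\<kappa> + 1)) {0..T}"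
          using has_integral_const_real[of "\<kappa> + 1" 0 T] elim by simp
        then show ?thesis
          by (intro has_integral_mult_right has_integral_add has_integral_divide integrable_integral ints)
      qed
      have "integral {0..T} C \<le> K * P * (T * (\<kappa> + 1) + integral {0..T} X / a + integral {0..T} Y / b)"
      proof (rule has_integral_le[OF integrable_integral[OF True] affine])
        fix t assume t: "t \<in> {0..T}"
        have "(X t * Y t) powr (3/8) + 1 \<le> P * (1 + X t / a + Y t / b) + \<kappa> * P"
          using powr_product_le_affine[of "X t" "Y t" a b] X(2)[of t] Y(2)[of t] t a bpos one
          unfolding P_def by (intro add_mono) auto
        then have "K * ((X t * Y t) powr (3/8) + 1) \<le> K * (P * (1 + X t / a + Y t / b) + \<kappa> * P)"
          using K by (intro mult_left_mono)
        then show "C t \<le> K * P * (\<kappa> + 1 + X t / a + Y t / b)"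
          using C[of t] t by (simp add: algebra_simps)
      qed
      then have "running_mean C T \<le> K * P * (T * (\<kappa> + 1) + integral {0..T} X / a + integral {0..T} Y / b) / T"
        unfolding running_mean_def using elim by (simp add: divide_right_mono)
      also have "\<dots> = K * P * (\<kappa> + 1 + running_mean X T / a + running_mean Y T / b)"
        unfolding running_mean_def using elim by (simp add: field_simps)
      also have "\<dots> \<le> K * P * (\<kappa> + 1 + 2 * a / a + 2 * b / b)"
        using elim a bpos K P by (intro mult_left_mono add_mono divide_right_mono) auto
      also have "\<dots> = K * (\<kappa> + 5) * P" using a bpos by (simp add: algebra_simps)
      finally show ?thesis .
    qed
  qed
  then show ?thesis unfolding P_def by (rule time_average_leI)
qed

lemma crest_average_bound:
  assumes L: "L > 0" and \<nu>: "\<nu> > 0" and f: "smooth_on UNIV f" "periodic L f"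
    and bdd: "bdd_above (range (\<lambda>n. deriv_energy L (Suc n) f / deriv_energy L n f))"
    and big0: "(visc_time L \<nu>)\<^sup>2 * deriv_energy L 0 f > 1"
    and big1: "(visc_time L \<nu>)\<^sup>2 * deriv_energy L 1 f > 1"
    and NS: "smooth_periodic_NS_solution L \<nu> f u0 u p"
    and grad: "bdd_above ((\<lambda>t. grad_sup_norm L (u t)) ` {0..})"
  shows "time_average (\<lambda>t. crest_factor L \<nu> f (u t))
    \<le> ereal ((7 + 18 * L\<^sup>2) * (L powr (3/2) + 5) * (length0 L f powr (-3/4) *
         (3 * (1 / \<nu>) * real_of_ereal (time_average (\<lambda>t. grad_sup_norm L (u t)))
            + length0 L f powi (-2)) powr (3/8)))"
proof -
  note One_nat_def[simp del]
  define G where "G = (\<lambda>t. grad_sup_norm L (u t))"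
  have smu: "smooth_on spacetime (\<lambda>(x, t). u t x)"
    using NS unfolding smooth_periodic_NS_solution_def by blast
  define U where "U = (\<lambda>i. \<lambda>(x, t). u t x $ i)"
  have smU: "smooth_on spacetime (U i)" for i
    unfolding U_def by (rule smooth_on_spacetime_vec_nth[OF smu])
  define DU where "DU = (\<lambda>i j. \<lambda>(x, t). pderiv_at j (\<lambda>y. U i (y, t)) x)"
  have smDU: "smooth_on spacetime (DU i j)" for i j
    unfolding DU_def by (rule smooth_on_spacetime_pderiv[OF smU])
  define DDU where "DDU = (\<lambda>i j k. \<lambda>(x, t). pderiv_at j (\<lambda>y. DU i k (y, t)) x)"
  have smDDU: "smooth_on spacetime (DDU i j k)" for i j k
    unfolding DDU_def by (rule smooth_on_spacetime_pderiv[OF smDU])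
  have slice: "smooth_on UNIV (\<lambda>x. u t x $ i)" if "t \<ge> 0" for t i
    using smooth_on_slice[OF smU that, of i] by (simp add: U_def)
  have mb: "momentum_balance L \<nu> (\<lambda>i x. u t x $ i) (\<lambda>i x. time_deriv (U i) (x, t)) (\<lambda>i x. f x $ i) (p t)"
    if "t \<ge> 0" for t
    using momentum_balance_NS[OF L \<nu> f NS that] by (simp add: U_def)
  have J0: "deriv_energy L 0 (u t) = (\<Sum>i\<in>UNIV. cell_integral L (\<lambda>x. (U i (x, t))\<^sup>2))" for t
    by (simp add: deriv_energy_0 U_def)
  have J1: "deriv_energy L 1 (u t) = (\<Sum>i\<in>UNIV. \<Sum>j\<in>UNIV. cell_integral L (\<lambda>x. (DU i j (x, t))\<^sup>2))" for t
    by (simp only: deriv_energy_1 U_def DU_def prod.case)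
  have J2: "deriv_energy L 2 (u t)
      = (\<Sum>i\<in>UNIV. \<Sum>j\<in>UNIV. \<Sum>k\<in>UNIV. cell_integral L (\<lambda>x. (DDU i j k (x, t))\<^sup>2))" if "t \<ge> 0" for t
    using deriv_energy_2[of "u t", OF slice[OF that]] by (simp only: U_def DU_def DDU_def prod.case)
  define F where "F = (\<lambda>n t. forced_energy L \<nu> f n (u t))"
  have F: "F n t = deriv_energy L n (u t) + (visc_time L \<nu>)\<^sup>2 * deriv_energy L n f" for n t
    by (simp add: F_def forced_energy_def)
  have F01: "F 0 t \<ge> 1" "F 1 t \<ge> 1" for t
    using big0 big1 deriv_energy_nonneg[of L 0 "u t"] deriv_energy_nonneg[of L 1 "u t"]
    unfolding F by linarith+
  have Fnn: "F n t \<ge> 0" for n t unfolding F by (simp add: deriv_energy_nonneg)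
  have "deriv_energy L 0 f > 0" "deriv_energy L 1 f > 0"
    using big0 big1 deriv_energy_nonneg[of L 0 f] deriv_energy_nonneg[of L 1 f]
    by (auto simp: order_less_le)
  then obtain \<Lambda> where \<Lambda>: "\<Lambda> > 0" "deriv_energy L 1 f \<le> \<Lambda> * deriv_energy L 0 f"
      "deriv_energy L 2 f \<le> \<Lambda> * deriv_energy L 1 f"
    and len: "length0 L f powi (-2) = \<Lambda> + 1 / L\<^sup>2"
      "length0 L f powr (-3/4) = (\<Lambda> + 1 / L\<^sup>2) powr (3/8)"
    by (rule length_scales[OF L bdd])
  define a where "a = \<Lambda> + 1 / L\<^sup>2"
  have a: "a > 0" "1 / L\<^sup>2 \<le> a" unfolding a_def using \<Lambda>(1) L by (auto simp: add_pos_pos)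
  have der0: "(F 0 has_field_derivative
      (\<Sum>i\<in>UNIV. 2 * cell_integral L (\<lambda>x. u t x $ i * time_deriv (U i) (x, t)))) (at t within {0..})"
    if "t \<ge> 0" for t
  proof -
    have "((\<lambda>t. (\<Sum>i\<in>UNIV. cell_integral L (\<lambda>x. (U i (x, t))\<^sup>2)) + (visc_time L \<nu>)\<^sup>2 * deriv_energy L 0 f)
      has_field_derivative (\<Sum>i\<in>UNIV. 2 * cell_integral L (\<lambda>x. U i (x, t) * time_deriv (U i) (x, t))) + 0)
      (at t within {0..})"
      by (intro DERIV_add DERIV_sum DERIV_const cell_integral_square_derivative smU that)
    then show ?thesis unfolding F J0[symmetric] by (simp add: U_def F[abs_def])
  qed
  have der1: "(F 1 has_field_derivative
      (\<Sum>i\<in>UNIV. \<Sum>j\<in>UNIV. 2 * cell_integral L (\<lambda>x. pderiv_at j (\<lambda>x. u t x $ i) x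
          * pderiv_at j (\<lambda>x. time_deriv (U i) (x, t)) x))) (at t within {0..})"
    if "t \<ge> 0" for t
  proof -
    have "((\<lambda>t. (\<Sum>i\<in>UNIV. \<Sum>j\<in>UNIV. cell_integral L (\<lambda>x. (DU i j (x, t))\<^sup>2)) + (visc_time L \<nu>)\<^sup>2 * deriv_energy L 1 f)
      has_field_derivative (\<Sum>i\<in>UNIV. \<Sum>j\<in>UNIV. 2 * cell_integral L (\<lambda>x. DU i j (x, t) * time_deriv (DU i j) (x, t))) + 0)
      (at t within {0..})"
      by (intro DERIV_add DERIV_sum DERIV_const cell_integral_square_derivative smDU that)
    moreover have "time_deriv (DU i j) (x, t) = pderiv_at j (\<lambda>x. time_deriv (U i) (x, t)) x" for i j x
      unfolding DU_def by (rule time_deriv_pderiv_commute[OF smU that])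
    moreover have "DU i j (x, t) = pderiv_at j (\<lambda>x. u t x $ i) x" for i j x
      by (simp add: DU_def U_def)
    ultimately show ?thesis unfolding J1[symmetric] F[abs_def] by (simp only: add_0_right)
  qed
  have contF: "continuous_on {0..} (F 0)" "continuous_on {0..} (F 1)"
    unfolding continuous_on_eq_continuous_within
    by (auto intro!: DERIV_continuous[OF der0] DERIV_continuous[OF der1])
  have "continuous_on {0..} (\<lambda>t. \<Sum>i\<in>UNIV. \<Sum>j\<in>UNIV. \<Sum>k\<in>UNIV. cell_integral L (\<lambda>x. (DDU i j k (x, t))\<^sup>2))"
    by (intro continuous_intros continuous_on_cell_integral_square smDDU)
  then have "continuous_on {0..} (\<lambda>t. deriv_energy L 2 (u t))"
    by (rule continuous_on_eq) (simp add: J2)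
  then have contF2: "continuous_on {0..} (F 2)"
    unfolding F[abs_def] by (intro continuous_intros)
  have FG: "forced_energy L \<nu> f n (u t) = F n t" "grad_sup_norm L (u t) = G t" for n t
    by (simp_all add: F_def G_def)
  have lad0: "(\<Sum>i\<in>UNIV. 2 * cell_integral L (\<lambda>x. u t x $ i * time_deriv (U i) (x, t)))
      \<le> 2 * (\<nu> * a - \<nu> * (F 1 t / F 0 t)) * F 0 t" if "t \<ge> 0" for t
    using energy_ladder_0[OF mb[OF that] \<Lambda>(1,2)] F01(1)[of t]
    unfolding a_def[symmetric] FG by (simp add: algebra_simps)
  have lad1: "(\<Sum>i\<in>UNIV. \<Sum>j\<in>UNIV. 2 * cell_integral L (\<lambda>x. pderiv_at j (\<lambda>x. u t x $ i) x
          * pderiv_at j (\<lambda>x. time_deriv (U i) (x, t)) x))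
      \<le> 2 * ((3 * G t + \<nu> * a) - \<nu> * (F 2 t / F 1 t)) * F 1 t" if "t \<ge> 0" for t
    using energy_ladder_1[OF mb[OF that] \<Lambda>(1,3)] F01(2)[of t]
    unfolding a_def[symmetric] FG by (simp add: algebra_simps)
  have F0ne: "F 0 t \<noteq> 0" "F 1 t \<noteq> 0" for t using F01[of t] by auto
  have contX: "continuous_on {0..} (\<lambda>t. F 1 t / F 0 t)" "continuous_on {0..} (\<lambda>t. F 2 t / F 1 t)"
    by (intro continuous_intros contF contF2; use F0ne in auto)+
  have contG: "continuous_on {0..} G"
    unfolding G_def by (rule continuous_on_grad_sup_norm[OF L smu])
  obtain B where B: "\<And>t. t \<ge> 0 \<Longrightarrow> G t \<le> B"
    using grad unfolding bdd_above_def G_def by auto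
  obtain x0 where x0: "x0 \<in> torus_cell L" using torus_cell_nonempty[OF L] by auto
  have G0: "G t \<ge> 0" if "t \<ge> 0" for t
    using abs_pderiv_le_grad_sup_norm[of "u t" 1 x0 L 1, OF slice[OF that] x0] unfolding G_def by linarith
  define b where "b = 3 * (1 / \<nu>) * real_of_ereal (time_average G) + a"
  have "a \<le> b"
    unfolding b_def using time_average_bounded(1)[OF contG G0 B] \<nu> by simp
  \<comment> \<open>both \<open>a\<close> and \<open>b\<close> are at least \<open>1 / L\<^sup>2\<close>\<close>
  have one: "1 \<le> L powr (3/2) * (a powr (3/8) * b powr (3/8))"
  proof -
    have "1 = L powr (3/2) * ((1 / L\<^sup>2) powr (3/8) * (1 / L\<^sup>2) powr (3/8))"
    proof -
      have "(1 / L\<^sup>2) powr (3/8) = L powr (-3/4)"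
      proof -
        have "1 / L\<^sup>2 = L powr (-2)" using L powr_minus_divide[of L 2] by simp
        then show ?thesis by (simp add: powr_powr)
      qed
      then show ?thesis using L by (simp add: powr_add[symmetric])
    qed
    also have "\<dots> \<le> L powr (3/2) * (a powr (3/8) * b powr (3/8))"
      using a \<open>a \<le> b\<close> by (intro mult_left_mono mult_mono powr_mono2) auto
    finally show ?thesis .
  qed
  have "time_average (\<lambda>t. crest_factor L \<nu> f (u t))
      \<le> ereal ((7 + 18 * L\<^sup>2) * (L powr (3/2) + 5) * (a powr (3/8) * b powr (3/8)))"
  proof (rule crest_average_combination[OF \<nu> a(1) _ _ contX(1) _ contX(2) _ contG G0 B])
    show "\<nu> * integral {0..T} (\<lambda>t. F 1 t / F 0 t) \<le> integral {0..T} (\<lambda>t. \<nu> * a) + ln (F 0 0) / 2"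
      if "T \<ge> 0" for T
      by (rule mean_growth_rate_bound[OF \<nu> that F01(1) der0 lad0])
         (auto intro!: integrable_continuous_real continuous_on_subset[OF contX(1)])
    show "\<nu> * integral {0..T} (\<lambda>t. F 2 t / F 1 t) \<le> integral {0..T} (\<lambda>t. 3 * G t + \<nu> * a) + ln (F 1 0) / 2"
      if "T \<ge> 0" for T
      by (rule mean_growth_rate_bound[OF \<nu> that F01(2) der1 lad1])
         (auto intro!: integrable_continuous_real continuous_intros continuous_on_subset[OF contX(2)]
            continuous_on_subset[OF contG])
    show "crest_factor L \<nu> f (u t) \<le> (7 + 18 * L\<^sup>2) * ((F 1 t / F 0 t * (F 2 t / F 1 t)) powr (3/8) + 1)"
      if "t \<ge> 0" for t
      using crest_factor_le[of L "u t" \<nu> f, OF L slice[OF that]] F01(1)[of t] F0ne(2)[of t]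
      by (simp add: F_def)
  qed (use Fnn one in \<open>auto simp: b_def\<close>)
  then show ?thesis unfolding len b_def a_def G_def by (simp add: mult_ac)
qed

theorem theorem4p2:
  fixes L :: real
  assumes "L > 0"
  shows "\<exists>c1>0. \<exists>c2>0. c1 = 3 \<and>
    (\<forall>(\<nu>::real) (f :: real^3 \<Rightarrow> real^3) (u0 :: real^3 \<Rightarrow> real^3)
      (u :: real \<Rightarrow> real^3 \<Rightarrow> real^3) (p :: real \<Rightarrow> real^3 \<Rightarrow> real).
      \<nu> > 0 \<longrightarrow>
      smooth_on UNIV f \<longrightarrow> periodic L f \<longrightarrow> integral (torus_cell L) f = 0 \<longrightarrow>
      bdd_above (range (\<lambda>n. deriv_energy L (Suc n) f / deriv_energy L n f)) \<longrightarrow>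
      (visc_time L \<nu>)\<^sup>2 * deriv_energy L 0 f > 1 \<longrightarrow>
      (visc_time L \<nu>)\<^sup>2 * deriv_energy L 1 f > 1 \<longrightarrow>
      smooth_periodic_NS_solution L \<nu> f u0 u p \<longrightarrow>
      integral (torus_cell L) u0 = 0 \<longrightarrow>
      bdd_above ((\<lambda>t. grad_sup_norm L (u t)) ` {0..}) \<longrightarrow>
      time_average (\<lambda>t. crest_factor L \<nu> f (u t))
        \<le> ereal (L powr (3/2) * c2 * length0 L f powr (-3/4) *
            (c1 * (1 / \<nu>) * real_of_ereal (time_average (\<lambda>t. grad_sup_norm L (u t)))
              + length0 L f powi (-2)) powr (3/8)))"
proof -
  define c2 where "c2 = (7 + 18 * L\<^sup>2) * (L powr (3/2) + 5) / L powr (3/2)"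
  have "7 + 18 * L\<^sup>2 > 0" "L powr (3/2) + 5 > 0" by (auto intro: add_pos_nonneg add_nonneg_pos)
  then have c2: "c2 > 0" unfolding c2_def using assms by simp
  have scale: "(7 + 18 * L\<^sup>2) * (L powr (3/2) + 5) = L powr (3/2) * c2"
    using assms by (simp add: c2_def)
  show ?thesis
    by (rule exI[of _ 3], intro conjI exI[of _ c2])
       (use c2 crest_average_bound[OF assms, unfolded scale] in \<open>auto simp: mult.assoc\<close>)
qed

end
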